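(* Let $\Omega\subseteq\mathbb{C}$ be a connected open set, $B$ a unital $C^*$-algebra, $\mathcal{U}=\mathscr{L}(l^2(\mathbb{N},B))$, $n\ge1$, and let $\mathcal{I},\mathcal{J}\in\mathcal{I}_n(\Omega,\mathcal{U})$. Then the following statements are equivalent: (1) $\mathcal{I}\sim_s\mathcal{J}$. (2) There exist $\lambda_0\in\Omega$ and an invertible operator $X_{\lambda_0}\in\mathcal{U}$ such that (i) $X_{\lambda_0}\,\mathscr{K}_{i,j}(\mathcal{I})(\lambda_0)=\mathscr{K}_{i,j}(\mathcal{J})(\lambda_0)\,X_{\lambda_0}$ for all $i,j\ge0$; and (ii) $X_{\lambda_0}\,\partial^i\mathcal{I}(\lambda_0)\,\overline{\partial}^j\mathcal{I}(\lambda_0)=\partial^i\mathcal{J}(\lambda_0)\,\overline{\partial}^j\mathcal{J}(\lambda_0)\,X_{\lambda_0}$ for all $i,j\ge0$.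
   Context: Notation: $\partial=\partial/\partial\lambda$, $\overline{\partial}=\partial/\partial\overline{\lambda}$, $\partial^0\mathcal{I}=\overline\partial^0\mathcal{I}=\mathcal{I}$. $l^2(\mathbb{N},B)$ is the standard Hilbert $B$-module of square-summable sequences in $B$, with inner product $\langle a,b\rangle=\sum_i b_i^*a_i$, and $\mathscr{L}(l^2(\mathbb{N},B))$ is the $C^*$-algebra of (adjointable) bounded operators on it. An extended holomorphic curve is a real-analytic map $\mathcal{I}$ from $\Omega$ to the set of idempotents of $\mathcal{U}$ such that on $\Omega$: $\overline{\partial}\mathcal{I}=\mathcal{I}\,\overline{\partial}\mathcal{I}$, $\partial\mathcal{I}=(\partial\mathcal{I})\mathcal{I}$, $(\overline{\partial}\mathcal{I})\mathcal{I}=0$, $\mathcal{I}\,\partial\mathcal{I}=0$. The class $\mathcal{I}_n(\Omega,\mathcal{U})$: extended holomorphic curves of the form $\mathcal{I}(\lambda)=\alpha(\lambda)(\beta^*(\lambda)\alpha(\lambda))^{-1}\beta^*(\lambda)$, where $\alpha(\lambda)(w_1,\dots,w_n)=\sum_i\alpha_i(\lambda)w_i$ and $\beta(\lambda)(w_1,\dots,w_n)=\sum_i\beta_i(\lambda)w_i$ (operators on $n$-tuples) for holomorphic functions $\alpha_i,\beta_i:\Omega\to l^2(\mathbb{N},B)$, $\beta^*(\lambda)$ is the adjoint of $\beta(\lambda)$, and the $n\times n$ matrix $\beta^*(\lambda)\alpha(\lambda)$ is invertible for all $\lambda$. Extended curvature and covariant derivatives: $\mathscr{K}_{0,0}(\mathcal{I})=\overline{\partial}\mathcal{I}\,\partial\mathcal{I}$,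 $\mathscr{K}_{i+1,0}(\mathcal{I})=\mathcal{I}\,\partial(\mathscr{K}_{i,0}(\mathcal{I}))$, $\mathscr{K}_{i,j+1}(\mathcal{I})=\overline{\partial}(\mathscr{K}_{i,j}(\mathcal{I}))\,\mathcal{I}$. Similarity: $\mathcal{I}\sim_s\mathcal{J}$ means there is a fixed invertible $X\in\mathcal{U}$ with $X\mathcal{I}(\lambda)=\mathcal{J}(\lambda)X$ for all $\lambda\in\Omega$. *)

theory Defs
  imports "HOL-Analysis.Analysis" "HOL-Computational_Algebra.Formal_Power_Series"
begin

class scaleC =
  fixes scaleC :: "complex \<Rightarrow> 'a \<Rightarrow> 'a" (infixr \<open>*\<^sub>C\<close> 75)

class complex_normed_vector = real_normed_vector + scaleC +
  assumes scaleC_add_right: "c *\<^sub>C (x + y) = c *\<^sub>C x + c *\<^sub>C y"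
    and scaleC_add_left: "(c + d) *\<^sub>C x = c *\<^sub>C x + d *\<^sub>C x"
    and scaleC_scaleC: "c *\<^sub>C d *\<^sub>C x = (c * d) *\<^sub>C x"
    and scaleR_scaleC: "r *\<^sub>R x = complex_of_real r *\<^sub>C x"
    and norm_scaleC: "norm (c *\<^sub>C x) = cmod c * norm x"

(* Unital complex C*-algebras with 1 \<noteq> 0. *)
class cstar_algebra_1 = real_normed_algebra_1 + banach + complex_normed_vector +
  fixes star :: "'a \<Rightarrow> 'a"
  assumes scaleC_mult_left: "(c *\<^sub>C x) * y = c *\<^sub>C (x * y)"
    and scaleC_mult_right: "x * (c *\<^sub>C y) = c *\<^sub>C (x * y)"
    and star_add: "star (x + y) = star x + star y"
    and star_scaleC: "star (c *\<^sub>C x) = cnj c *\<^sub>C star x"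
    and star_mult: "star (x * y) = star y * star x"
    and star_star: "star (star x) = x"
    and norm_star_mult: "norm (star x * x) = (norm x)\<^sup>2"

lemma scaleC_of_real: "complex_of_real r *\<^sub>C (x::'a::complex_normed_vector) = r *\<^sub>R x"
  by (simp add: scaleR_scaleC)

lemma scaleC_zero_right [simp]: "c *\<^sub>C (0::'a::complex_normed_vector) = 0"
  using scaleC_add_right[of c "0::'a" 0] by simp

lemma scaleC_minus_right: "c *\<^sub>C (- x::'a::complex_normed_vector) = - (c *\<^sub>C x)"
  using scaleC_add_right[of c x "- x"] by (simp add: eq_neg_iff_add_eq_0 add.commute)

lemma scaleC_minus_left: "(- c) *\<^sub>C (x::'a::complex_normed_vector) = - (c *\<^sub>C x)"
  using scaleC_add_left[of "- c" c x] scaleC_of_real[of 0 x] by (simp add: eq_neg_iff_add_eq_0)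

lemma scaleC_diff_right: "c *\<^sub>C (x - y::'a::complex_normed_vector) = c *\<^sub>C x - c *\<^sub>C y"
  using scaleC_add_right[of c x "- y"] by (simp add: scaleC_minus_right)

lemma scaleC_ii_ii: "\<i> *\<^sub>C \<i> *\<^sub>C (x::'a::complex_normed_vector) = - x"
  using scaleC_of_real[of "-1" x] by (simp add: scaleC_scaleC)

lemma bounded_linear_scaleC_right: "bounded_linear (\<lambda>x::'a::complex_normed_vector. c *\<^sub>C x)"
proof (rule bounded_linear_intro)
  fix r :: real and x y :: 'a
  show "c *\<^sub>C (x + y) = c *\<^sub>C x + c *\<^sub>C y" by (rule scaleC_add_right)
  show "c *\<^sub>C (r *\<^sub>R x) = r *\<^sub>R (c *\<^sub>C x)" by (simp add: scaleR_scaleC scaleC_scaleC mult.commute)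
  show "norm (c *\<^sub>C x) \<le> norm x * cmod c" by (simp add: norm_scaleC mult.commute)
qed

subsection \<open>Positive elements of a C*-algebra\<close>

(* Needed only for the Cauchy-Schwarz inequality of the standard Hilbert module, i.e. for its norm:
   a* a has a self-adjoint square root, and 0 \<le> x \<le> y implies that the norm of x is at most
   the norm of y. *)

lemma star_zero [simp]: "star (0::'a::cstar_algebra_1) = 0"
  using star_add[of "0::'a" 0] by simp

lemma star_minus [simp]: "star (- x::'a::cstar_algebra_1) = - star x"
  using star_add[of x "- x"] by (simp add: eq_neg_iff_add_eq_0 add.commute)

lemma star_diff: "star (x - y::'a::cstar_algebra_1) = star x - star y"
  using star_add[of x "- y"] by simp

lemma star_one [simp]: "star (1::'a::cstar_algebra_1) = 1"
  using star_mult[of "star 1::'a" 1] by (simp add: star_star)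

lemma star_scaleR: "star (r *\<^sub>R x::'a::cstar_algebra_1) = r *\<^sub>R star x"
  by (simp add: scaleR_scaleC star_scaleC)

lemma star_sum: "star (sum f A) = (\<Sum>i\<in>A. star (f i::'a::cstar_algebra_1))"
  by (induction A rule: infinite_finite_induct) (auto simp: star_add)

lemma star_power: "star (x ^ n) = (star x::'a::cstar_algebra_1) ^ n"
  by (induction n) (auto simp: star_mult power_commutes)

lemma norm_star [simp]: "norm (star x::'a::cstar_algebra_1) = norm x"
proof -
  have *: "norm y \<le> norm (star y)" for y :: 'a
  proof (cases "y = 0")
    case False
    have "norm y * norm y \<le> norm (star y) * norm y"
      using norm_star_mult[of y] norm_mult_ineq[of "star y" y] by (simp add: power2_eq_square)
    with False show ?thesis by simp
  qed simp
  from *[of x] *[of "star x"] show ?thesis by (simp add: star_star)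
qed

lemma bounded_linear_star: "bounded_linear (star :: 'a::cstar_algebra_1 \<Rightarrow> 'a)"
  by (rule bounded_linear_intro[where K=1]) (auto simp: star_add star_scaleR)

lemma star_mult_eq_0: "star x * x = 0 \<longleftrightarrow> x = (0::'a::cstar_algebra_1)"
  using norm_star_mult[of x] by auto

definition self_adj :: "'a::cstar_algebra_1 \<Rightarrow> bool" where "self_adj x \<longleftrightarrow> star x = x"

lemma norm_sa_sq: "self_adj h \<Longrightarrow> norm (h * h) = (norm h)\<^sup>2"
  using norm_star_mult[of h] by (simp add: self_adj_def)

lemma sa_sq_eq_0: "self_adj h \<Longrightarrow> h * h = 0 \<longleftrightarrow> h = 0"
  using norm_sa_sq[of h] by auto

definition positive :: "'a::cstar_algebra_1 \<Rightarrow> bool" where "positive a \<longleftrightarrow> (\<exists>h. self_adj h \<and> h * h = a)"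

lemma pos_sa: "positive a \<Longrightarrow> self_adj a"
  by (auto simp: positive_def self_adj_def star_mult)

definition sqrt_coeff :: "nat \<Rightarrow> real" where
  "sqrt_coeff k = (-1) ^ k * ((1/2) gchoose k)"

lemma sqrt_coeff_0 [simp]: "sqrt_coeff 0 = 1"
  by (simp add: sqrt_coeff_def)

lemma sqrt_coeff_Suc: "sqrt_coeff (Suc k) = sqrt_coeff k * (real k - 1/2) / (real k + 1)"
proof -
  have aux: "- (s * (x * g / d)) = (- x) * (s * g) / d" for s x g d :: real
    by simp
  have "(1/2) * ((1/2::real) gchoose k) = real k * ((1/2) gchoose k) + real (Suc k) * ((1/2) gchoose Suc k)"
    by (rule gbinomial_mult_1)
  then have "real (Suc k) * ((1/2) gchoose Suc k) = (1/2 - real k) * ((1/2) gchoose k)"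
    by (simp add: left_diff_distrib)
  then have "(1/2::real) gchoose Suc k = (1/2 - real k) * ((1/2) gchoose k) / (real k + 1)"
    by (simp add: eq_divide_eq ac_simps)
  then have "sqrt_coeff (Suc k) = - ((-1) ^ k * ((1/2 - real k) * ((1/2) gchoose k) / (real k + 1)))"
    by (simp add: sqrt_coeff_def)
  also have "\<dots> = (- (1/2 - real k)) * ((-1) ^ k * ((1/2) gchoose k)) / (real k + 1)"
    by (rule aux)
  finally show ?thesis by (simp add: sqrt_coeff_def)
qed

lemma sqrt_coeff_nonpos: "sqrt_coeff (Suc k) \<le> 0"
proof (induction k)
  case (Suc k)
  show ?case
    by (subst sqrt_coeff_Suc) (use Suc in \<open>auto intro!: divide_nonpos_pos mult_nonpos_nonneg\<close>)
qed (simp add: sqrt_coeff_Suc)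

lemma sqrt_coeff_partial: "(\<Sum>k<n. \<bar>sqrt_coeff (Suc k)\<bar>) \<le> 1"
proof -
  have *: "(\<Sum>k<n. \<bar>sqrt_coeff (Suc k)\<bar> * x ^ Suc k) \<le> 1" if x: "0 < x" "x < 1" for x :: real
  proof -
    have "(\<lambda>n. ((1/2) gchoose n) * (- x)^n) sums (1 + (- x)) powr (1/2)"
      by (rule gen_binomial_real) (use x in auto)
    then have "(\<lambda>n. sqrt_coeff n * x ^ n) sums (1 - x) powr (1/2)"
      by (simp add: sqrt_coeff_def power_minus[of x] mult_ac)
    then have "(\<lambda>n. sqrt_coeff (Suc n) * x ^ Suc n) sums ((1 - x) powr (1/2) - 1)"
      by (subst sums_Suc_iff) simp
    from sums_minus[OF this]
    have s: "(\<lambda>n. \<bar>sqrt_coeff (Suc n)\<bar> * x ^ Suc n) sums (1 - (1 - x) powr (1/2))"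
      by (simp add: abs_of_nonpos[OF sqrt_coeff_nonpos])
    have "(\<Sum>k<n. \<bar>sqrt_coeff (Suc k)\<bar> * x ^ Suc k) \<le> (\<Sum>k. \<bar>sqrt_coeff (Suc k)\<bar> * x ^ Suc k)"
      by (rule sum_le_suminf) (use s x in \<open>auto simp: sums_iff\<close>)
    also have "\<dots> \<le> 1" using s by (simp add: sums_iff)
    finally show ?thesis .
  qed
  have "((\<lambda>x. \<Sum>k<n. \<bar>sqrt_coeff (Suc k)\<bar> * x ^ Suc k) \<longlongrightarrow> (\<Sum>k<n. \<bar>sqrt_coeff (Suc k)\<bar> * 1 ^ Suc k)) (at_left 1)"
    by (intro tendsto_intros)
  moreover have "eventually (\<lambda>x. (\<Sum>k<n. \<bar>sqrt_coeff (Suc k)\<bar> * x ^ Suc k) \<le> 1) (at_left 1)"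
    by (rule eventually_mono[OF eventually_at_left_real[of 0 "1::real"]]) (use * in auto)
  ultimately show ?thesis
    using tendsto_upperbound[of _ _ "at_left (1::real)" 1] by force
qed

lemma summable_sqrt_coeff: "summable (\<lambda>k. \<bar>sqrt_coeff k\<bar>)"
proof -
  have "summable (\<lambda>k. \<bar>sqrt_coeff (Suc k)\<bar>)"
    by (rule summableI_nonneg_bounded[where x=1]) (auto simp: sqrt_coeff_partial)
  then show ?thesis using summable_Suc_iff[of "\<lambda>k. \<bar>sqrt_coeff k\<bar>"] by blast
qed

lemma summable_sqrt_coeff_Suc: "summable (\<lambda>k. \<bar>sqrt_coeff (Suc k)\<bar>)"
  using summable_sqrt_coeff summable_Suc_iff[of "\<lambda>k. \<bar>sqrt_coeff k\<bar>"] by blast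

lemma suminf_sqrt_coeff: "(\<Sum>k. \<bar>sqrt_coeff (Suc k)\<bar>) \<le> 1"
  by (rule suminf_le_const) (use summable_sqrt_coeff_Suc sqrt_coeff_partial in auto)

lemma sqrt_coeff_conv:
  "(\<Sum>i\<le>k. sqrt_coeff i * sqrt_coeff (k - i)) = (if k = 0 then 1 else if k = 1 then -1 else 0)"
proof -
  have "(\<Sum>i\<le>k. sqrt_coeff i * sqrt_coeff (k - i))
     = (\<Sum>i\<in>{0..k}. (-1)^k * (((1/2) gchoose i) * ((1/2) gchoose (k - i))))"
    unfolding atLeast0AtMost[symmetric]
  proof (rule sum.cong)
    fix i assume "i \<in> {0..k}"
    then have "(-1)^k = (-1::real)^i * (-1)^(k-i)" by (simp flip: power_add)
    then show "sqrt_coeff i * sqrt_coeff (k - i) = (-1)^k * (((1/2) gchoose i) * ((1/2) gchoose (k - i)))"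
      by (simp add: sqrt_coeff_def)
  qed simp
  also have "\<dots> = (-1)^k * ((1/2 + 1/2) gchoose k)"
    by (simp only: sum_distrib_left[symmetric] gbinomial_Vandermonde)
  also have "\<dots> = (-1)^k * ((of_nat 1) gchoose k)" by simp
  also have "\<dots> = (-1)^k * real (1 choose k)" by (simp only: binomial_gbinomial)
  also have "\<dots> = (if k = 0 then 1 else if k = 1 then -1 else 0)"
    by (auto simp: binomial_eq_0)
  finally show ?thesis .
qed

definition sqrt1m :: "'a::cstar_algebra_1 \<Rightarrow> 'a" where
  "sqrt1m z = (\<Sum>k. sqrt_coeff k *\<^sub>R z ^ k)"

context
  fixes z :: "'a::cstar_algebra_1"
  assumes z: "norm z \<le> 1"
begin

lemma sqrt1m_term: "norm (sqrt_coeff k *\<^sub>R z ^ k) \<le> \<bar>sqrt_coeff k\<bar>"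
proof -
  have "norm (z ^ k) \<le> 1"
    using order_trans[OF norm_power_ineq[of z k] power_le_one[OF norm_ge_zero z]] .
  then show ?thesis by (simp add: mult_left_le)
qed

lemma sqrt1m_summable_norm: "summable (\<lambda>k. norm (sqrt_coeff k *\<^sub>R z ^ k))"
  by (rule summable_comparison_test'[OF summable_sqrt_coeff, of 0]) (use sqrt1m_term in auto)

lemma sqrt1m_summable: "summable (\<lambda>k. sqrt_coeff k *\<^sub>R z ^ k)"
  by (rule summable_norm_cancel[OF sqrt1m_summable_norm])

lemma sqrt1m_sq: "sqrt1m z * sqrt1m z = 1 - z"
proof -
  have "(\<lambda>k. \<Sum>i\<le>k. (sqrt_coeff i *\<^sub>R z ^ i) * (sqrt_coeff (k - i) *\<^sub>R z ^ (k - i))) sums (sqrt1m z * sqrt1m z)"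
    unfolding sqrt1m_def by (rule Cauchy_product_sums[OF sqrt1m_summable_norm sqrt1m_summable_norm])
  moreover have "(\<Sum>i\<le>k. (sqrt_coeff i *\<^sub>R z ^ i) * (sqrt_coeff (k - i) *\<^sub>R z ^ (k - i)))
      = (if k = 0 then 1 else if k = 1 then - z else 0)" for k
  proof -
    have "(\<Sum>i\<le>k. (sqrt_coeff i *\<^sub>R z ^ i) * (sqrt_coeff (k - i) *\<^sub>R z ^ (k - i)))
       = (\<Sum>i\<le>k. sqrt_coeff i * sqrt_coeff (k - i)) *\<^sub>R z ^ k"
      unfolding scaleR_sum_left by (rule sum.cong) (auto simp flip: power_add)
    then show ?thesis by (simp add: sqrt_coeff_conv)
  qed
  ultimately have "(\<lambda>k. if k = 0 then 1 else if k = 1 then - z else 0) sums (sqrt1m z * sqrt1m z)"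
    by simp
  moreover have "(\<lambda>k. if k = 0 then 1 else if k = 1 then - z else 0) sums
      (\<Sum>k\<in>{0,1::nat}. if k = 0 then 1 else if k = 1 then - z else 0)"
    by (rule sums_finite) auto
  ultimately show ?thesis by (simp add: sums_iff)
qed

lemma sqrt1m_commute:
  assumes "c * z = z * c"
  shows "c * sqrt1m z = sqrt1m z * c"
proof -
  have *: "c * z ^ k = z ^ k * c" for k
    using assms by (induction k) (simp_all add: mult.assoc, metis mult.assoc)
  have "c * sqrt1m z = (\<Sum>k. c * (sqrt_coeff k *\<^sub>R z ^ k))"
    unfolding sqrt1m_def by (rule suminf_mult[OF sqrt1m_summable, symmetric])
  also have "\<dots> = (\<Sum>k. (sqrt_coeff k *\<^sub>R z ^ k) * c)"
    by (simp add: *)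
  also have "\<dots> = sqrt1m z * c"
    unfolding sqrt1m_def by (rule suminf_mult2[OF sqrt1m_summable, symmetric])
  finally show ?thesis .
qed

lemma sqrt1m_sa: "self_adj z \<Longrightarrow> self_adj (sqrt1m z)"
  unfolding self_adj_def sqrt1m_def
  by (subst bounded_linear.suminf[OF bounded_linear_star sqrt1m_summable])
     (simp add: star_scaleR star_power)

lemma norm_1_sqrt1m: "norm (1 - sqrt1m z) \<le> 1"
proof -
  have sn: "summable (\<lambda>k. norm (sqrt_coeff (Suc k) *\<^sub>R z ^ Suc k))"
    using sqrt1m_summable_norm by (subst summable_Suc_iff)
  have "sqrt1m z = 1 + (\<Sum>k. sqrt_coeff (Suc k) *\<^sub>R z ^ Suc k)"
    unfolding sqrt1m_def using suminf_split_head[OF sqrt1m_summable] by simp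
  then have "norm (1 - sqrt1m z) = norm (\<Sum>k. sqrt_coeff (Suc k) *\<^sub>R z ^ Suc k)" by simp
  also have "\<dots> \<le> (\<Sum>k. norm (sqrt_coeff (Suc k) *\<^sub>R z ^ Suc k))"
    by (rule summable_norm[OF sn])
  also have "\<dots> \<le> (\<Sum>k. \<bar>sqrt_coeff (Suc k)\<bar>)"
    by (rule suminf_le) (use sqrt1m_term sn summable_sqrt_coeff_Suc in \<open>auto simp del: power_Suc\<close>)
  also have "\<dots> \<le> 1" by (rule suminf_sqrt_coeff)
  finally show ?thesis .
qed

end

lemma sqrt_of_norm_bound0:
  fixes a :: "'a::cstar_algebra_1"
  assumes "self_adj a" "norm (s *\<^sub>R 1 - a) \<le> s" "s > 0"
  obtains h where "self_adj h" "h * h = a" "\<And>c. c * a = a * c \<Longrightarrow> c * h = h * c"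
    "norm (sqrt s *\<^sub>R 1 - h) \<le> sqrt s"
proof -
  define z where "z = 1 - (1/s) *\<^sub>R a"
  have sz: "s *\<^sub>R z = s *\<^sub>R 1 - a" using assms by (simp add: z_def scaleR_diff_right)
  then have "norm (s *\<^sub>R z) \<le> s" using assms by simp
  then have nz: "norm z \<le> 1" using assms(3) by simp
  have saz: "self_adj z" using assms by (simp add: z_def self_adj_def star_diff star_scaleR)
  define h where "h = sqrt s *\<^sub>R sqrt1m z"
  show thesis
  proof
    show "self_adj h" using sqrt1m_sa[OF nz saz] by (simp add: h_def self_adj_def star_scaleR)
    have "h * h = s *\<^sub>R (1 - z)" using assms by (simp add: h_def sqrt1m_sq[OF nz])
    then show "h * h = a" using assms by (simp add: z_def)
    show "c * h = h * c" if "c * a = a * c" for c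
    proof -
      have "c * z = z * c" using that by (simp add: z_def algebra_simps)
      from sqrt1m_commute[OF nz this] show ?thesis by (simp add: h_def)
    qed
    have "norm (sqrt s *\<^sub>R 1 - h) = sqrt s * norm (1 - sqrt1m z)"
      using assms by (simp add: h_def flip: scaleR_diff_right)
    also have "\<dots> \<le> sqrt s * 1" using norm_1_sqrt1m[OF nz] assms by (intro mult_left_mono) auto
    finally show "norm (sqrt s *\<^sub>R 1 - h) \<le> sqrt s" by simp
  qed
qed

lemma sqrt_of_norm_bound:
  fixes a :: "'a::cstar_algebra_1"
  assumes "self_adj a" "norm (s *\<^sub>R 1 - a) \<le> s"
  obtains h where "positive h" "h * h = a" "\<And>c. c * a = a * c \<Longrightarrow> c * h = h * c"
proof (cases "s > 0")
  case True
  obtain h where h: "self_adj h" "h * h = a" "\<And>c. c * a = a * c \<Longrightarrow> c * h = h * c"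
    "norm (sqrt s *\<^sub>R 1 - h) \<le> sqrt s" using sqrt_of_norm_bound0[OF assms True] by blast
  have "sqrt s > 0" using True by simp
  then obtain k where "self_adj k" "k * k = h" using sqrt_of_norm_bound0[OF h(1,4)] by blast
  then have "positive h" unfolding positive_def by blast
  with h that show ?thesis by blast
next
  case False
  then have "s = 0" using assms norm_ge_zero[of "s *\<^sub>R 1 - a"] by linarith
  then have "a = 0" using assms by simp
  moreover have "positive (0::'a)" unfolding positive_def by (rule exI[of _ 0]) (simp add: self_adj_def)
  ultimately show ?thesis using that[of 0] by simp
qed

lemma norm_sq_le:
  fixes h k :: "'a::cstar_algebra_1"
  assumes "self_adj h" "self_adj k" "h * k = k * h" "h * h + k * k = s *\<^sub>R 1" "s \<ge> 0"
  shows "norm (h * h) \<le> s"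
proof -
  define u where "u = h + \<i> *\<^sub>C k"
  have su: "star u = h - \<i> *\<^sub>C k"
    using assms by (simp add: u_def star_add star_scaleC self_adj_def scaleC_minus_left)
  have "star u * u = h * h + k * k"
    unfolding su using assms(3)
    by (simp add: u_def algebra_simps scaleC_mult_left scaleC_mult_right scaleC_ii_ii scaleC_diff_right)
  then have "(norm u)\<^sup>2 = s" using norm_star_mult[of u] assms by simp
  then have nu: "norm u = sqrt s" using real_sqrt_unique[OF _ norm_ge_zero, of u s] by simp
  have "u + star u = 2 *\<^sub>R h" unfolding su by (simp add: u_def scaleR_2)
  then have "h = (1/2) *\<^sub>R (u + star u)" by simp
  then have "norm h = norm (u + star u) / 2" using norm_scaleR[of "1/2" "u + star u"] by simp
  also have "\<dots> \<le> sqrt s" using norm_triangle_ineq[of u "star u"] nu by simp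
  finally have "(norm h)\<^sup>2 \<le> s" using power_mono[of "norm h" "sqrt s" 2] assms by simp
  then show ?thesis using norm_sa_sq[OF assms(1)] by simp
qed

lemma norm_bound_of_sq:
  fixes h :: "'a::cstar_algebra_1"
  assumes "self_adj h" "norm (h * h) \<le> s"
  shows "norm (s *\<^sub>R 1 - h * h) \<le> s"
proof (cases "s > 0")
  case True
  have "self_adj (s *\<^sub>R 1 - h * h)" using assms by (simp add: self_adj_def star_diff star_scaleR star_mult)
  moreover have "norm (s *\<^sub>R 1 - (s *\<^sub>R 1 - h * h)) \<le> s" using assms by simp
  ultimately obtain k where k: "positive k" "k * k = s *\<^sub>R 1 - h * h"
    "\<And>c. c * (s *\<^sub>R 1 - h * h) = (s *\<^sub>R 1 - h * h) * c \<Longrightarrow> c * k = k * c"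
    using sqrt_of_norm_bound by blast
  have "h * k = k * h" by (rule k) (simp add: algebra_simps)
  then have "norm (k * k) \<le> s"
    using norm_sq_le[of k h s] assms(1) k(1,2) True pos_sa[of k] by simp
  then show ?thesis by (simp add: k)
next
  case False
  then have "s = 0" using assms norm_ge_zero[of "h * h"] by linarith
  then show ?thesis using assms by simp
qed

lemma pos_norm_bound:
  fixes a :: "'a::cstar_algebra_1"
  shows "positive a \<Longrightarrow> norm a \<le> s \<Longrightarrow> norm (s *\<^sub>R 1 - a) \<le> s"
  unfolding positive_def using norm_bound_of_sq by blast

lemma posI_norm_bound:
  fixes a :: "'a::cstar_algebra_1"
  assumes "self_adj a" "norm (s *\<^sub>R 1 - a) \<le> s"
  shows "positive a"
proof -
  from sqrt_of_norm_bound[OF assms] obtain h where "positive h" "h * h = a" by blast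
  then show ?thesis using pos_sa[of h] positive_def[of a] by blast
qed

lemma pos_sqrt:
  fixes a :: "'a::cstar_algebra_1"
  assumes "positive a"
  obtains h where "positive h" "h * h = a" "\<And>c. c * a = a * c \<Longrightarrow> c * h = h * c"
  using sqrt_of_norm_bound[OF pos_sa[OF assms] pos_norm_bound[OF assms order_refl]] by blast

lemma pos_add:
  fixes a b :: "'a::cstar_algebra_1"
  assumes "positive a" "positive b"
  shows "positive (a + b)"
proof (rule posI_norm_bound)
  show "self_adj (a + b)" using assms[THEN pos_sa] by (simp add: self_adj_def star_add)
  have "norm ((norm a *\<^sub>R 1 - a) + (norm b *\<^sub>R 1 - b)) \<le> norm a + norm b"
    by (intro norm_triangle_mono pos_norm_bound assms order_refl)
  then show "norm ((norm a + norm b) *\<^sub>R 1 - (a + b)) \<le> norm a + norm b"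
    by (simp add: algebra_simps)
qed

lemma pos_sq: "self_adj h \<Longrightarrow> positive (h * h :: 'a::cstar_algebra_1)"
  unfolding positive_def by blast

lemma pos_0 [simp]: "positive (0::'a::cstar_algebra_1)"
  using pos_sq[of "0::'a"] by (simp add: self_adj_def)

lemma pos_1 [simp]: "positive (1::'a::cstar_algebra_1)"
  using pos_sq[of "1::'a"] by (simp add: self_adj_def)

lemma pos_scaleR: 
  assumes "positive (a::'a::cstar_algebra_1)" "r \<ge> 0"
  shows "positive (r *\<^sub>R a)"
proof -
  from assms obtain h where h: "self_adj h" "h * h = a" by (auto simp: positive_def)
  show ?thesis unfolding positive_def
    by (rule exI[of _ "sqrt r *\<^sub>R h"]) (use h assms in \<open>auto simp: self_adj_def star_scaleR\<close>)
qed

lemma pos_mult_commute: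
  fixes a b :: "'a::cstar_algebra_1"
  assumes "positive a" "positive b" "a * b = b * a"
  shows "positive (a * b)"
proof -
  obtain h where h: "positive h" "h * h = a" "\<And>c. c * a = a * c \<Longrightarrow> c * h = h * c"
    using pos_sqrt[OF assms(1)] by blast
  obtain k where k: "positive k" "k * k = b" "\<And>c. c * b = b * c \<Longrightarrow> c * k = k * c"
    using pos_sqrt[OF assms(2)] by blast
  have "b * h = h * b" using h(3) assms(3) by simp
  then have hk: "h * k = k * h" using k(3) by simp
  have "a * b = (h * k) * (h * k)" using h(2) k(2) hk by (metis mult.assoc)
  moreover have "self_adj (h * k)" using pos_sa[OF h(1)] pos_sa[OF k(1)] hk by (simp add: self_adj_def star_mult)
  ultimately show ?thesis using pos_sq by metis
qed

lemma norm_minus_pos: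
  fixes a :: "'a::cstar_algebra_1"
  assumes "self_adj a" "norm a \<le> s"
  shows "positive (s *\<^sub>R 1 - a)"
  by (rule posI_norm_bound[where s=s]) (use assms in \<open>auto simp: self_adj_def star_diff star_scaleR\<close>)

lemma pos_le_norm:
  fixes x :: "'a::cstar_algebra_1"
  assumes "positive x" "positive (s *\<^sub>R 1 - x)" "s \<ge> 0"
  shows "norm x \<le> s"
proof -
  obtain h where h: "positive h" "h * h = x" "\<And>c. c * x = x * c \<Longrightarrow> c * h = h * c"
    using pos_sqrt[OF assms(1)] by blast
  obtain k where k: "positive k" "k * k = s *\<^sub>R 1 - x"
     "\<And>c. c * (s *\<^sub>R 1 - x) = (s *\<^sub>R 1 - x) * c \<Longrightarrow> c * k = k * c"
    using pos_sqrt[OF assms(2)] by blast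
  have "x * h = h * x" using h(3) by simp
  then have "h * k = k * h" by (intro k(3)) (simp add: algebra_simps)
  then have "norm (h * h) \<le> s"
    using norm_sq_le[of h k s] assms(3) h(2) k(2) pos_sa[OF h(1)] pos_sa[OF k(1)] by simp
  then show ?thesis by (simp add: h)
qed

lemma pos_norm_mono:
  fixes x :: "'a::cstar_algebra_1"
  assumes "positive x" "positive (y - x)"
  shows "norm x \<le> norm y"
proof (rule pos_le_norm[OF assms(1)])
  have "positive y" using pos_add[OF assms] by simp
  then have "positive (norm y *\<^sub>R 1 - y)" using norm_minus_pos[OF pos_sa] by blast
  from pos_add[OF this assms(2)] show "positive (norm y *\<^sub>R 1 - x)" by simp
qed simp

lemma pos_conj:
  fixes a :: "'a::cstar_algebra_1"
  assumes "positive a" "\<And>x::'a. positive (star x * x)"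
  shows "positive (star c * a * c)"
proof -
  from assms obtain h where h: "self_adj h" "h * h = a" by (auto simp: positive_def)
  have "star c * a * c = star (h * c) * (h * c)"
    using h by (simp add: star_mult self_adj_def mult.assoc flip: h(2))
  then show ?thesis using assms(2) by metis
qed

lemma pos_plus_inverse:
  fixes w :: "'a::cstar_algebra_1"
  assumes "positive w" "t > 0"
  obtains r where "(w + t *\<^sub>R 1) * r = 1" "r * (w + t *\<^sub>R 1) = 1"
proof -
  define s where "s = norm w + t"
  have s: "s > 0" using assms by (simp add: s_def add_nonneg_pos)
  define q where "q = 1 - (1/s) *\<^sub>R (w + t *\<^sub>R 1)"
  have "s *\<^sub>R q = norm w *\<^sub>R 1 - w"
    using s by (simp add: q_def scaleR_diff_right) (simp add: s_def algebra_simps)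
  then have "s * norm q = norm (norm w *\<^sub>R 1 - w)" using s by (metis abs_of_pos norm_scaleR)
  also have "\<dots> \<le> norm w" by (rule pos_norm_bound[OF assms(1) order_refl])
  also have "\<dots> < s" using assms by (simp add: s_def)
  finally have nq: "norm q < 1" using s by simp
  have sm: "summable (\<lambda>n. q ^ n)" by (rule complete_algebra_summable_geometric[OF nq])
  define r where "r = (\<Sum>n. q ^ n)"
  have e: "r = 1 + (\<Sum>n. q ^ Suc n)"
    unfolding r_def using suminf_split_head[OF sm] by simp
  have "(\<Sum>n. q ^ Suc n) = q * r" unfolding r_def using suminf_mult[OF sm, of q] by simp
  moreover have "(\<Sum>n. q ^ Suc n) = r * q" unfolding r_def using suminf_mult2[OF sm, of q] by (simp add: power_commutes)
  ultimately have "r - q * r = 1" "r - r * q = 1" using e by (metis add_diff_cancel_right')+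
  then have "(1 - q) * r = 1" "r * (1 - q) = 1" by (simp_all add: left_diff_distrib right_diff_distrib)
  then show ?thesis
    by (intro that[of "(1/s) *\<^sub>R r"]) (auto simp: q_def)
qed

lemma pos_norm_not_invertible:
  fixes p :: "'a::cstar_algebra_1"
  assumes "positive p" "(norm p *\<^sub>R 1 - p) * d = 1" "d * (norm p *\<^sub>R 1 - p) = 1"
  shows "p = 0"
proof (rule ccontr)
  assume "p \<noteq> 0"
  define c where "c = norm p *\<^sub>R 1 - p"
  have cd: "c * d = 1" "d * c = 1" using assms by (auto simp: c_def)
  have pc: "positive c" unfolding c_def using norm_minus_pos[OF pos_sa] assms(1) by blast
  obtain k where k: "positive k" "k * k = c" "\<And>x. x * c = c * x \<Longrightarrow> x * k = k * x"
    using pos_sqrt[OF pc] by blast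
  have dk: "d * k = k * d" using k(3) cd by simp
  have sd: "star d = d"
  proof -
    have "star d * c = 1" using arg_cong[OF cd(1), of star] pos_sa[OF pc] by (simp add: star_mult self_adj_def)
    then show ?thesis by (metis cd(1) mult.assoc mult.left_neutral mult.right_neutral)
  qed
  have "self_adj (k * d)" using pos_sa[OF k(1)] sd dk by (simp add: self_adj_def star_mult)
  then have "positive ((k * d) * (k * d))" by (rule pos_sq)
  moreover have "(k * d) * (k * d) = d" using k(2) cd dk by (metis mult.assoc mult.left_neutral)
  ultimately have pd: "positive d" by simp
  have nd: "norm d > 0" using cd by auto
  have "positive (norm d *\<^sub>R 1 - d)" using norm_minus_pos[OF pos_sa] pd by blast
  moreover have "c * (norm d *\<^sub>R 1 - d) = (norm d *\<^sub>R 1 - d) * c" using cd by (simp add: algebra_simps)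
  ultimately have "positive (c * (norm d *\<^sub>R 1 - d))" using pos_mult_commute[OF pc] by blast
  then have "positive (norm d *\<^sub>R c - 1)" using cd by (simp add: algebra_simps)
  from pos_scaleR[OF this, of "1 / norm d"] nd
  have P: "positive (c - (1 / norm d) *\<^sub>R 1)" by (simp add: scaleR_diff_right)
  define s where "s = max (norm p - 1 / norm d) 0"
  have "positive ((s - (norm p - 1 / norm d)) *\<^sub>R (1::'a))" by (rule pos_scaleR) (auto simp: s_def)
  from pos_add[OF P this] have "positive (s *\<^sub>R 1 - p)" by (simp add: c_def algebra_simps)
  then have "norm p \<le> s" by (rule pos_le_norm[OF assms(1)]) (simp add: s_def)
  moreover have "norm p > 0" using \<open>p \<noteq> 0\<close> by simp
  ultimately show False using nd by (auto simp: s_def max_def split: if_splits)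
qed

theorem pos_star_mult:
  fixes a :: "'a::cstar_algebra_1"
  shows "positive (star a * a)"
proof -
  define x where "x = star a * a"
  have sx: "self_adj x" by (simp add: x_def self_adj_def star_mult star_star)
  obtain q where q: "positive q" "q * q = x * x" "\<And>c. c * (x * x) = (x * x) * c \<Longrightarrow> c * q = q * c"
    using pos_sqrt[OF pos_sq[OF sx]] by blast
  have xq: "x * q = q * x" by (rule q(3)) (simp add: mult.assoc)
  obtain m where m: "positive m" "m * m = q" "\<And>c. c * q = q * c \<Longrightarrow> c * m = m * c"
    using pos_sqrt[OF q(1)] by blast
  define y where "y = q - x"
  have sy: "self_adj y" using sx pos_sa[OF q(1)] by (simp add: y_def self_adj_def star_diff)
  have yq: "y * q = q * y" using xq by (simp add: y_def algebra_simps)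
  have ym: "y * m = m * y" by (rule m(3)) (rule yq)
  have yy: "y * y = 2 *\<^sub>R (q * y)"
    using q(2) xq by (simp add: y_def algebra_simps scaleR_2)
  define b where "b = a * y"
  define g where "g = m * y"
  have sg: "self_adj g" using sy pos_sa[OF m(1)] ym by (simp add: g_def self_adj_def star_mult)
  have xy: "x * y = - (q * y)"
  proof -
    have "x * y = q * y - y * y" by (simp add: y_def algebra_simps)
    then show ?thesis by (simp add: yy scaleR_2)
  qed
  have "y * q * y = g * g" unfolding g_def using ym m(2) by (metis mult.assoc)
  moreover have "star b * b = y * (x * y)" using sy by (simp add: b_def x_def star_mult self_adj_def mult.assoc)
  ultimately have bb: "star b * b = - (g * g)" by (simp add: xy mult.assoc)
  define h where "h = (1/2) *\<^sub>R (b + star b)"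
  define k where "k = (1/2) *\<^sub>R (\<i> *\<^sub>C (star b - b))"
  have sh: "self_adj h" by (simp add: h_def self_adj_def star_add star_star star_scaleR add.commute)
  have sk: "self_adj k"
    by (simp add: k_def self_adj_def star_diff star_star star_scaleR star_scaleC scaleC_minus_left scaleC_diff_right)
  have ii: "(\<i> *\<^sub>C u) * (\<i> *\<^sub>C u) = - (u * u)" for u :: 'a
    by (simp add: scaleC_mult_left scaleC_mult_right scaleC_ii_ii)
  have hh: "h * h = (1/4) *\<^sub>R ((b + star b) * (b + star b))" by (simp add: h_def)
  have kk: "k * k = (1/4) *\<^sub>R (- ((star b - b) * (star b - b)))" by (simp add: k_def ii)
  have "h * h + k * k = (1/4) *\<^sub>R (2 *\<^sub>R (star b * b) + 2 *\<^sub>R (b * star b))"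
    unfolding hh kk scaleR_add_right[symmetric] by (simp add: algebra_simps scaleR_2)
  then have "2 *\<^sub>R (h * h + k * k) = star b * b + b * star b" by (simp add: scaleR_add_right)
  then have "b * star b = 2 *\<^sub>R (h * h + k * k) + g * g" using bb by simp
  then have pbb: "positive (b * star b)"
    using pos_add[OF pos_scaleR[OF pos_add[OF pos_sq[OF sh] pos_sq[OF sk]], of 2] pos_sq[OF sg]] by simp
  have gg0: "g * g = 0"
  proof (rule ccontr)
    assume "g * g \<noteq> 0"
    define t where "t = norm (g * g)"
    have t: "t > 0" using \<open>g * g \<noteq> 0\<close> by (simp add: t_def)
    obtain r where r: "(b * star b + t *\<^sub>R 1) * r = 1" "r * (b * star b + t *\<^sub>R 1) = 1"
      using pos_plus_inverse[OF pbb t] by blast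
    define d where "d = (1/t) *\<^sub>R (1 - star b * r * b)"
    have c: "t *\<^sub>R 1 - g * g = star b * b + t *\<^sub>R 1" using bb by simp
    have 1: "(star b * b + t *\<^sub>R 1) * (1 - star b * r * b) = t *\<^sub>R 1"
    proof -
      have "(star b * b + t *\<^sub>R 1) * (1 - star b * r * b)
         = star b * b + t *\<^sub>R 1 - star b * ((b * star b + t *\<^sub>R 1) * r) * b"
        by (simp add: algebra_simps)
      then show ?thesis by (simp add: r)
    qed
    have 2: "(1 - star b * r * b) * (star b * b + t *\<^sub>R 1) = t *\<^sub>R 1"
    proof -
      have "(1 - star b * r * b) * (star b * b + t *\<^sub>R 1)
         = star b * b + t *\<^sub>R 1 - star b * (r * (b * star b + t *\<^sub>R 1)) * b"
        by (simp add: algebra_simps)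
      then show ?thesis by (simp add: r)
    qed
    have "g * g = 0"
    proof (rule pos_norm_not_invertible[OF pos_sq[OF sg]])
      show "(norm (g * g) *\<^sub>R 1 - g * g) * d = 1"
        unfolding t_def[symmetric] c d_def using 1 t by simp
      show "d * (norm (g * g) *\<^sub>R 1 - g * g) = 1"
        unfolding t_def[symmetric] c d_def using 2 t by simp
    qed
    with \<open>g * g \<noteq> 0\<close> show False by simp
  qed
  then have "y * q * y = 0" using \<open>y * q * y = g * g\<close> by simp
  then have "y * (y * y) = 0" unfolding yy by (simp add: mult.assoc)
  then have "(y * y) * (y * y) = 0" by (simp add: mult.assoc)
  then have "y * y = 0" using sa_sq_eq_0[of "y * y"] sy by (simp add: self_adj_def star_mult)
  then have "y = 0" using sa_sq_eq_0[OF sy] by simp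
  then show ?thesis using q(1) by (simp add: y_def x_def)
qed

subsection \<open>The standard Hilbert module\<close>

(* Inner product and norm restricted to a finite set of coordinates. *)
definition fip :: "nat set \<Rightarrow> (nat \<Rightarrow> 'b) \<Rightarrow> (nat \<Rightarrow> 'b) \<Rightarrow> 'b::cstar_algebra_1" where
  "fip F a b = (\<Sum>i\<in>F. star (b i) * a i)"

definition fnorm :: "nat set \<Rightarrow> (nat \<Rightarrow> 'b::cstar_algebra_1) \<Rightarrow> real" where
  "fnorm F a = sqrt (norm (fip F a a))"

lemma pos_sum:
  fixes f :: "'i \<Rightarrow> 'b::cstar_algebra_1"
  shows "(\<And>i. i \<in> A \<Longrightarrow> positive (f i)) \<Longrightarrow> positive (sum f A)"
  by (induction A rule: infinite_finite_induct) (auto intro: pos_add)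

lemma pos_fip: "positive (fip F a a :: 'b::cstar_algebra_1)"
  unfolding fip_def by (intro pos_sum pos_star_mult)

lemma norm_fip_mono:
  fixes a :: "nat \<Rightarrow> 'b::cstar_algebra_1"
  assumes "finite G" "F \<subseteq> G"
  shows "norm (fip F a a) \<le> norm (fip G a a)"
proof (rule pos_norm_mono[OF pos_fip])
  have "fip G a a - fip F a a = fip (G - F) a a"
    unfolding fip_def using sum_diff[OF assms] by metis
  then show "positive (fip G a a - fip F a a)" by (simp add: pos_fip)
qed

lemma fnorm_mono: "finite G \<Longrightarrow> F \<subseteq> G \<Longrightarrow> fnorm F a \<le> fnorm G a"
  unfolding fnorm_def by (simp add: norm_fip_mono)

lemma fnorm_nonneg [simp]: "0 \<le> fnorm F a"
  by (simp add: fnorm_def)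

lemma fnorm_sq: "(fnorm F a)\<^sup>2 = norm (fip F a a)"
  by (simp add: fnorm_def)

lemma fnorm_singleton: "fnorm {i} a = norm (a i)"
  by (simp add: fnorm_def fip_def norm_star_mult)

lemma star_fip: "star (fip F a b) = fip F b a"
  by (simp add: fip_def star_sum star_mult star_star)

lemma fip_cauchy_schwarz_sq:
  fixes a b :: "nat \<Rightarrow> 'b::cstar_algebra_1"
  assumes "finite F"
  shows "(norm (fip F a b))\<^sup>2 \<le> norm (fip F a a) * norm (fip F b b)"
proof (cases "fip F a a = 0")
  case True
  have "a i = 0" if "i \<in> F" for i
  proof -
    have "norm (a i) \<le> fnorm F a"
      using fnorm_mono[OF assms, of "{i}" a] that by (simp add: fnorm_singleton)
    then show ?thesis using True by (simp add: fnorm_def)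
  qed
  then have "fip F a b = 0" by (simp add: fip_def)
  then show ?thesis by simp
next
  case False
  define A B c m where "A = fip F a a" and "B = fip F b b" and "c = fip F b a" and "m = norm A"
  have m: "m > 0" using False by (simp add: m_def A_def)
  define t where "t = 1 / m"
  have t: "t > 0" "t * m = 1" using m by (auto simp: t_def)
  have sc: "star c = fip F a b" by (simp add: c_def star_fip)
  define d where "d = (\<lambda>i. t *\<^sub>R (a i * c) - b i)"
  have "star (d i) * d i = (t * t) *\<^sub>R (star c * (star (a i) * a i) * c)
      - t *\<^sub>R (star c * (star (a i) * b i)) - t *\<^sub>R ((star (b i) * a i) * c) + star (b i) * b i" for i
    by (simp add: d_def star_diff star_scaleR star_mult left_diff_distrib right_diff_distrib scaleR_diff_right mult.assoc)
  then have fd: "fip F d d = (t * t) *\<^sub>R (star c * A * c) - t *\<^sub>R (star c * c) - t *\<^sub>R (star c * c) + B"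
    by (simp add: fip_def sum.distrib sum_subtractf A_def B_def
        scaleR_sum_right[symmetric] sum_distrib_left[symmetric] sum_distrib_right[symmetric])
      (simp add: sc c_def[symmetric] fip_def[symmetric])
  have "positive (star c * (m *\<^sub>R 1 - A) * c)"
    unfolding m_def A_def by (intro pos_conj norm_minus_pos pos_sa pos_fip order_refl pos_star_mult)
  then have "positive ((t * t) *\<^sub>R (star c * (m *\<^sub>R 1 - A) * c))"
    by (rule pos_scaleR) simp
  then have "positive ((t * t * m) *\<^sub>R (star c * c) - (t * t) *\<^sub>R (star c * A * c))"
    by (simp add: left_diff_distrib right_diff_distrib scaleR_diff_right)
  then have "positive (fip F d d + ((t * t * m) *\<^sub>R (star c * c) - (t * t) *\<^sub>R (star c * A * c)))"
    by (rule pos_add[OF pos_fip])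
  moreover have "t * t * m = t" using t by (simp add: mult.assoc)
  ultimately have "positive (B - t *\<^sub>R (star c * c))"
    unfolding fd by simp
  then have "norm (t *\<^sub>R (star c * c)) \<le> norm B"
    by (intro pos_norm_mono pos_scaleR pos_star_mult) (use t in auto)
  then have "t * (norm c)\<^sup>2 \<le> norm B" using t by (simp add: norm_star_mult)
  then have "m * (t * (norm c)\<^sup>2) \<le> m * norm B" using m by simp
  then have "(norm c)\<^sup>2 \<le> m * norm B" using t by (simp add: mult.assoc[symmetric] mult.commute[of m t])
  moreover have "norm (fip F a b) = norm c" using sc norm_star by metis
  ultimately show ?thesis by (simp add: m_def A_def B_def)
qed

lemma fip_cauchy_schwarz: "finite F \<Longrightarrow> norm (fip F a b) \<le> fnorm F a * fnorm F b"
  using fip_cauchy_schwarz_sq[of F a b] unfolding fnorm_def real_sqrt_mult[symmetric]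
  by (rule real_le_rsqrt)

lemma fnorm_add:
  fixes a b :: "nat \<Rightarrow> 'b::cstar_algebra_1"
  assumes "finite F"
  shows "fnorm F (\<lambda>i. a i + b i) \<le> fnorm F a + fnorm F b"
proof -
  have "fip F (\<lambda>i. a i + b i) (\<lambda>i. a i + b i) = fip F a a + fip F a b + fip F b a + fip F b b"
    by (simp add: fip_def star_add algebra_simps sum.distrib)
  then have "norm (fip F (\<lambda>i. a i + b i) (\<lambda>i. a i + b i))
    \<le> norm (fip F a a) + norm (fip F a b) + norm (fip F b a) + norm (fip F b b)"
    by (simp add: norm_triangle_le norm_triangle_mono)
  also have "\<dots> \<le> (fnorm F a)\<^sup>2 + fnorm F a * fnorm F b + fnorm F b * fnorm F a + (fnorm F b)\<^sup>2"
    by (intro add_mono fip_cauchy_schwarz assms) (auto simp: fnorm_sq)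
  also have "\<dots> = (fnorm F a + fnorm F b)\<^sup>2" by (simp add: power2_sum)
  finally show ?thesis unfolding fnorm_def[of F "\<lambda>i. a i + b i"] by (rule real_le_lsqrt[rotated]) simp
qed

definition l2_seq :: "(nat \<Rightarrow> 'b::cstar_algebra_1) set" where
  "l2_seq = {a. summable (\<lambda>i. star (a i) * a i)}"

lemma l2_seq_iff_tails: "a \<in> l2_seq \<longleftrightarrow> (\<forall>e>0. \<exists>N. \<forall>m\<ge>N. \<forall>n. fnorm {m..<n} a < e)"
proof -
  have "a \<in> l2_seq \<longleftrightarrow> (\<forall>e>0. \<exists>N. \<forall>m\<ge>N. \<forall>n. norm (fip {m..<n} a a) < e)"
    by (simp add: l2_seq_def summable_Cauchy fip_def)
  also have "\<dots> \<longleftrightarrow> (\<forall>e>0. \<exists>N. \<forall>m\<ge>N. \<forall>n. fnorm {m..<n} a < e)" (is "?L = ?R")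
  proof
    assume L: ?L
    show ?R
    proof (intro allI impI)
      fix e :: real assume e: "e > 0"
      then have "e\<^sup>2 > 0" by simp
      with L obtain N where N: "\<And>m n. m \<ge> N \<Longrightarrow> norm (fip {m..<n} a a) < e\<^sup>2" by blast
      have "fnorm {m..<n} a < e" if "m \<ge> N" for m n
        unfolding fnorm_def using real_sqrt_less_mono[OF N[OF that]] e by simp
      then show "\<exists>N. \<forall>m\<ge>N. \<forall>n. fnorm {m..<n} a < e" by blast
    qed
  next
    assume R: ?R
    show ?L
    proof (intro allI impI)
      fix e :: real assume e: "e > 0"
      then have "sqrt e > 0" by simp
      with R obtain N where N: "\<And>m n. m \<ge> N \<Longrightarrow> fnorm {m..<n} a < sqrt e" by blast
      have "norm (fip {m..<n} a a) < e" if "m \<ge> N" for m n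
        using N[OF that] unfolding fnorm_def by simp
      then show "\<exists>N. \<forall>m\<ge>N. \<forall>n. norm (fip {m..<n} a a) < e" by blast
    qed
  qed
  finally show ?thesis .
qed

lemma l2_seq_tails:
  assumes "a \<in> l2_seq" "e > 0"
  obtains N where "\<And>m n. m \<ge> N \<Longrightarrow> fnorm {m..<n} a < e"
  using assms unfolding l2_seq_iff_tails by blast

lemma l2_seq_add:
  assumes "a \<in> l2_seq" "b \<in> l2_seq"
  shows "(\<lambda>i. a i + b i) \<in> l2_seq"
  unfolding l2_seq_iff_tails
proof (intro allI impI)
  fix e :: real assume "e > 0"
  then have e: "e / 2 > 0" by simp
  obtain N1 where N1: "\<And>m n. m \<ge> N1 \<Longrightarrow> fnorm {m..<n} a < e / 2"
    using l2_seq_tails[OF assms(1) e] by blast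
  obtain N2 where N2: "\<And>m n. m \<ge> N2 \<Longrightarrow> fnorm {m..<n} b < e / 2"
    using l2_seq_tails[OF assms(2) e] by blast
  have "fnorm {m..<n} (\<lambda>i. a i + b i) < e" if "m \<ge> max N1 N2" for m n
    using fnorm_add[of "{m..<n}" a b] N1[of m n] N2[of m n] that by simp
  then show "\<exists>N. \<forall>m\<ge>N. \<forall>n. fnorm {m..<n} (\<lambda>i. a i + b i) < e" by blast
qed

lemma star_scaleC_mult:
  "star (c *\<^sub>C x) * (d *\<^sub>C y) = (cnj c * d) *\<^sub>C (star x * (y::'b::cstar_algebra_1))"
  by (simp add: star_scaleC scaleC_mult_left scaleC_mult_right scaleC_scaleC mult.commute)

lemma summable_scaleC: "summable f \<Longrightarrow> summable (\<lambda>i. c *\<^sub>C (f i :: 'b::{banach,complex_normed_vector}))"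
  by (rule bounded_linear.summable[OF bounded_linear_scaleC_right])

lemma l2_seq_scaleC: "a \<in> l2_seq \<Longrightarrow> (\<lambda>i. c *\<^sub>C a i) \<in> l2_seq"
  by (simp add: l2_seq_def star_scaleC_mult summable_scaleC)

lemma l2_seq_scaleR: "a \<in> l2_seq \<Longrightarrow> (\<lambda>i. r *\<^sub>R a i) \<in> l2_seq"
  unfolding scaleR_scaleC by (rule l2_seq_scaleC)

lemma l2_seq_minus: "a \<in> l2_seq \<Longrightarrow> (\<lambda>i. - a i) \<in> l2_seq"
  by (simp add: l2_seq_def)

lemma l2_seq_diff: "a \<in> l2_seq \<Longrightarrow> b \<in> l2_seq \<Longrightarrow> (\<lambda>i. a i - b i) \<in> l2_seq"
  using l2_seq_add[OF _ l2_seq_minus, of a b] by simp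

lemma l2_seq_rmult:
  assumes "a \<in> l2_seq"
  shows "(\<lambda>i. a i * b) \<in> l2_seq"
proof -
  have "summable (\<lambda>i. star b * (star (a i) * a i) * b)"
    by (intro summable_mult summable_mult2) (use assms in \<open>simp add: l2_seq_def\<close>)
  then show ?thesis by (simp add: l2_seq_def star_mult mult.assoc)
qed

lemma l2_seq_summable_inner:
  assumes "a \<in> l2_seq" "b \<in> l2_seq"
  shows "summable (\<lambda>i. star (b i) * a i)"
  unfolding summable_Cauchy
proof (intro allI impI)
  fix e :: real assume "e > 0"
  then have e: "sqrt e > 0" by simp
  obtain N1 where N1: "\<And>m n. m \<ge> N1 \<Longrightarrow> fnorm {m..<n} a < sqrt e"
    using l2_seq_tails[OF assms(1) e] by blast
  obtain N2 where N2: "\<And>m n. m \<ge> N2 \<Longrightarrow> fnorm {m..<n} b < sqrt e"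
    using l2_seq_tails[OF assms(2) e] by blast
  have "norm (\<Sum>i=m..<n. star (b i) * a i) < e" if "m \<ge> max N1 N2" for m n
  proof -
    have "norm (fip {m..<n} a b) \<le> fnorm {m..<n} a * fnorm {m..<n} b"
      by (rule fip_cauchy_schwarz) simp
    also have "\<dots> < sqrt e * sqrt e"
      by (intro mult_strict_mono') (use N1[of m n] N2[of m n] that in auto)
    also have "\<dots> = e" using \<open>e > 0\<close> by simp
    finally show ?thesis by (simp add: fip_def)
  qed
  then show "\<exists>N. \<forall>m\<ge>N. \<forall>n. norm (\<Sum>i=m..<n. star (b i) * a i) < e" by blast
qed

typedef (overloaded) 'b l2 = "{a :: nat \<Rightarrow> 'b::cstar_algebra_1. summable (\<lambda>i. star (a i) * a i)}"
  morphisms l2_nth Abs_l2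
  by (rule exI[of _ "\<lambda>_. 0"]) simp

setup_lifting type_definition_l2

lemma l2_nth_seq: "l2_nth a \<in> l2_seq"
  using l2_nth[of a] by (simp add: l2_seq_def)

lemma l2_eqI: "(\<And>i. l2_nth a i = l2_nth b i) \<Longrightarrow> a = b"
  by (simp add: l2_nth_inject[symmetric] fun_eq_iff)

definition l2_inner :: "'b l2 \<Rightarrow> 'b l2 \<Rightarrow> 'b::cstar_algebra_1" where
  "l2_inner a b = (\<Sum>i. star (l2_nth b i) * l2_nth a i)"

lift_definition l2_rmult :: "'b l2 \<Rightarrow> 'b \<Rightarrow> 'b::cstar_algebra_1 l2" (infixl \<open>\<bullet>\<^sub>B\<close> 75)
  is "\<lambda>a b i. a i * b"
  using l2_seq_rmult by (simp add: l2_seq_def)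

instantiation l2 :: (cstar_algebra_1) real_vector
begin

lift_definition zero_l2 :: "'a l2" is "\<lambda>i. 0" by simp
lift_definition plus_l2 :: "'a l2 \<Rightarrow> 'a l2 \<Rightarrow> 'a l2" is "\<lambda>a b i. a i + b i"
  using l2_seq_add by (simp add: l2_seq_def)
lift_definition minus_l2 :: "'a l2 \<Rightarrow> 'a l2 \<Rightarrow> 'a l2" is "\<lambda>a b i. a i - b i"
  using l2_seq_diff by (simp add: l2_seq_def)
lift_definition uminus_l2 :: "'a l2 \<Rightarrow> 'a l2" is "\<lambda>a i. - a i" by simp
lift_definition scaleR_l2 :: "real \<Rightarrow> 'a l2 \<Rightarrow> 'a l2" is "\<lambda>r a i. r *\<^sub>R a i"
  using l2_seq_scaleR by (simp add: l2_seq_def)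

instance
  by standard (transfer; simp add: fun_eq_iff algebra_simps)+

end

instantiation l2 :: (cstar_algebra_1) scaleC
begin

lift_definition scaleC_l2 :: "complex \<Rightarrow> 'a l2 \<Rightarrow> 'a l2" is "\<lambda>c a i. c *\<^sub>C a i"
  using l2_seq_scaleC by (simp add: l2_seq_def)

instance ..

end

lemmas l2_nth_simps [simp] =
  zero_l2.rep_eq plus_l2.rep_eq minus_l2.rep_eq uminus_l2.rep_eq scaleR_l2.rep_eq
  scaleC_l2.rep_eq l2_rmult.rep_eq

lemma l2_summable_inner: "summable (\<lambda>i. star (l2_nth b i) * l2_nth a i)"
  by (rule l2_seq_summable_inner[OF l2_nth_seq l2_nth_seq])

lemma l2_inner_sums: "(\<lambda>i. star (l2_nth b i) * l2_nth a i) sums l2_inner a b"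
  unfolding l2_inner_def by (rule summable_sums[OF l2_summable_inner])

lemma l2_inner_LIMSEQ: "(\<lambda>n. fip {..<n} (l2_nth a) (l2_nth b)) \<longlonglongrightarrow> l2_inner a b"
  using l2_inner_sums[of b a] by (simp add: sums_def fip_def)

lemma l2_inner_add_left: "l2_inner (a + a') b = l2_inner a b + l2_inner a' b"
  using sums_add[OF l2_inner_sums[of b a] l2_inner_sums[of b a']] l2_inner_sums[of b "a + a'"]
  by (simp add: algebra_simps sums_iff)

lemma l2_inner_star: "star (l2_inner a b) = l2_inner b a"
  using bounded_linear.sums[OF bounded_linear_star l2_inner_sums[of b a]] l2_inner_sums[of a b]
  by (simp add: star_mult star_star sums_iff)

lemma l2_inner_add_right: "l2_inner a (b + b') = l2_inner a b + l2_inner a b'"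
  using l2_inner_add_left[of b b' a] by (metis l2_inner_star star_add)

lemma l2_inner_scaleC_left: "l2_inner (c *\<^sub>C a) b = c *\<^sub>C l2_inner a b"
  using bounded_linear.sums[OF bounded_linear_scaleC_right[of c] l2_inner_sums[of b a]] l2_inner_sums[of b "c *\<^sub>C a"]
  by (simp add: scaleC_mult_right sums_iff)

lemma l2_inner_scaleC_right: "l2_inner a (c *\<^sub>C b) = cnj c *\<^sub>C l2_inner a b"
  using l2_inner_scaleC_left[of c b a] by (metis l2_inner_star star_scaleC)

lemma l2_inner_rmult_left: "l2_inner (a \<bullet>\<^sub>B m) b = l2_inner a b * m"
  using sums_mult2[OF l2_inner_sums[of b a], of m] l2_inner_sums[of b "a \<bullet>\<^sub>B m"]
  by (simp add: mult.assoc sums_iff)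

lemma l2_inner_rmult_right: "l2_inner a (b \<bullet>\<^sub>B m) = star m * l2_inner a b"
  using l2_inner_rmult_left[of b m a] by (metis l2_inner_star star_mult)

lemma scaleR_scaleC_l2: "r *\<^sub>R (a :: 'b::cstar_algebra_1 l2) = complex_of_real r *\<^sub>C a"
  by transfer (simp add: scaleR_scaleC)

lemma l2_inner_scaleR_left: "l2_inner (r *\<^sub>R a) b = r *\<^sub>R l2_inner a b"
  unfolding scaleR_scaleC_l2 l2_inner_scaleC_left by (simp add: scaleR_scaleC)

lemma l2_inner_scaleR_right: "l2_inner a (r *\<^sub>R b) = r *\<^sub>R l2_inner a b"
  unfolding scaleR_scaleC_l2 l2_inner_scaleC_right by (simp add: scaleR_scaleC)

lemma l2_inner_minus_left: "l2_inner (- a) b = - l2_inner a b"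
  using l2_inner_scaleR_left[of "-1" a b] by simp

lemma l2_inner_minus_right: "l2_inner a (- b) = - l2_inner a b"
  using l2_inner_scaleR_right[of a "-1" b] by simp

lemma l2_inner_diff_left: "l2_inner (a - a') b = l2_inner a b - l2_inner a' b"
  using l2_inner_add_left[of a "- a'" b] by (simp add: l2_inner_minus_left)

lemma l2_inner_diff_right: "l2_inner a (b - b') = l2_inner a b - l2_inner a b'"
  using l2_inner_add_right[of a b "- b'"] by (simp add: l2_inner_minus_right)

lemma l2_inner_zero_left [simp]: "l2_inner 0 b = 0"
  by (simp add: l2_inner_def)

lemma l2_inner_zero_right [simp]: "l2_inner a 0 = 0"
  by (simp add: l2_inner_def)

instantiation l2 :: (cstar_algebra_1) real_normed_vector
begin

definition norm_l2 :: "'a l2 \<Rightarrow> real" where "norm_l2 a = sqrt (norm (l2_inner a a))"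
definition sgn_l2 :: "'a l2 \<Rightarrow> 'a l2" where "sgn_l2 a = inverse (norm a) *\<^sub>R a"
definition dist_l2 :: "'a l2 \<Rightarrow> 'a l2 \<Rightarrow> real" where "dist_l2 a b = norm (a - b)"
definition uniformity_l2 :: "('a l2 \<times> 'a l2) filter" where
  "uniformity_l2 = (INF e\<in>{0<..}. principal {(x, y). dist x y < e})"
definition open_l2 :: "'a l2 set \<Rightarrow> bool" where
  "open_l2 U = (\<forall>x\<in>U. eventually (\<lambda>(x', y). x' = x \<longrightarrow> y \<in> U) uniformity)"

lemma fnorm_LIMSEQ: "(\<lambda>n. fnorm {..<n} (l2_nth a)) \<longlonglongrightarrow> norm a"
  unfolding fnorm_def norm_l2_def by (intro tendsto_intros l2_inner_LIMSEQ)

lemma fnorm_le_norm: "finite F \<Longrightarrow> fnorm F (l2_nth a) \<le> norm a"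
proof -
  assume F: "finite F"
  then obtain N where N: "F \<subseteq> {..<N}" using finite_nat_iff_bounded by blast
  have "eventually (\<lambda>n. fnorm F (l2_nth a) \<le> fnorm {..<n} (l2_nth a)) sequentially"
    using eventually_ge_at_top[of N] by eventually_elim (use N in \<open>auto intro!: fnorm_mono\<close>)
  then show ?thesis using tendsto_lowerbound[OF fnorm_LIMSEQ] by simp
qed

lemma norm_l2_nth: "norm (l2_nth a i) \<le> norm a"
  using fnorm_le_norm[of "{i}" a] by (simp add: fnorm_singleton)

instance
proof
  fix a b :: "'a l2" and r :: real
  show "dist a b = norm (a - b)" by (simp add: dist_l2_def)
  show "sgn a = inverse (norm a) *\<^sub>R a" by (simp add: sgn_l2_def)
  show "norm a = 0 \<longleftrightarrow> a = 0"
    using norm_l2_nth[of a] by (auto intro!: l2_eqI) (simp add: norm_l2_def)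
  show "norm (a + b) \<le> norm a + norm b"
  proof (rule LIMSEQ_le[OF fnorm_LIMSEQ tendsto_add[OF fnorm_LIMSEQ fnorm_LIMSEQ]])
    show "\<exists>N. \<forall>n\<ge>N. fnorm {..<n} (l2_nth (a + b)) \<le> fnorm {..<n} (l2_nth a) + fnorm {..<n} (l2_nth b)"
      by (simp add: fnorm_add)
  qed
  show "norm (r *\<^sub>R a) = \<bar>r\<bar> * norm a"
    by (simp add: norm_l2_def l2_inner_scaleR_left l2_inner_scaleR_right real_sqrt_mult)
qed (fact uniformity_l2_def open_l2_def)+

end

lemma norm_l2_sq: "(norm a)\<^sup>2 = norm (l2_inner a a)" for a :: "'b::cstar_algebra_1 l2"
  by (simp add: norm_l2_def)

lemma l2_inner_cauchy_schwarz: "norm (l2_inner a b) \<le> norm a * norm b"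
proof (rule LIMSEQ_le[OF tendsto_norm[OF l2_inner_LIMSEQ] tendsto_mult[OF fnorm_LIMSEQ fnorm_LIMSEQ]])
  show "\<exists>N. \<forall>n\<ge>N. norm (fip {..<n} (l2_nth a) (l2_nth b)) \<le> fnorm {..<n} (l2_nth a) * fnorm {..<n} (l2_nth b)"
    by (simp add: fip_cauchy_schwarz)
qed

lemma l2_inner_self_eq_0: "l2_inner a a = 0 \<longleftrightarrow> a = 0"
  using norm_l2_sq[of a] by auto

lemma l2_inner_eqI:
  assumes "\<And>x. l2_inner x a = l2_inner x b"
  shows "a = b"
  using assms[of "a - b"] l2_inner_self_eq_0[of "a - b"] by (simp add: l2_inner_diff_right)

lemma bounded_bilinear_l2_inner: "bounded_bilinear (l2_inner :: 'b::cstar_algebra_1 l2 \<Rightarrow> _)"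
  by standard (auto simp: l2_inner_add_left l2_inner_add_right l2_inner_scaleR_left l2_inner_scaleR_right
      intro!: exI[of _ 1] l2_inner_cauchy_schwarz)

lemma l2_rmult_bound: "norm (a \<bullet>\<^sub>B m) \<le> norm a * norm m"
proof -
  have "(norm (a \<bullet>\<^sub>B m))\<^sup>2 = norm (star m * l2_inner a a * m)"
    by (simp add: norm_l2_sq l2_inner_rmult_left l2_inner_rmult_right mult.assoc)
  also have "\<dots> \<le> norm (star m * l2_inner a a) * norm m" by (rule norm_mult_ineq)
  also have "\<dots> \<le> (norm (star m) * norm (l2_inner a a)) * norm m"
    by (intro mult_right_mono norm_mult_ineq norm_ge_zero)
  also have "\<dots> = (norm a * norm m)\<^sup>2"
    by (simp only: norm_star power_mult_distrib norm_l2_sq power2_eq_square[of "norm m"] ac_simps)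
  finally show ?thesis by (rule power2_le_imp_le) simp
qed

instance l2 :: (cstar_algebra_1) complex_normed_vector
proof
  fix c d :: complex and a b :: "'a l2" and r :: real
  show "c *\<^sub>C (a + b) = c *\<^sub>C a + c *\<^sub>C b" by transfer (simp add: scaleC_add_right)
  show "(c + d) *\<^sub>C a = c *\<^sub>C a + d *\<^sub>C a" by transfer (simp add: scaleC_add_left)
  show "c *\<^sub>C d *\<^sub>C a = (c * d) *\<^sub>C a" by transfer (simp add: scaleC_scaleC)
  show "r *\<^sub>R a = complex_of_real r *\<^sub>C a" by (rule scaleR_scaleC_l2)
  show "norm (c *\<^sub>C a) = cmod c * norm a"
    by (simp add: norm_l2_def l2_inner_scaleC_left l2_inner_scaleC_right norm_scaleC real_sqrt_mult
        flip: mult.assoc)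
qed

instance l2 :: (cstar_algebra_1) banach
proof
  fix X :: "nat \<Rightarrow> 'a l2" assume X: "Cauchy X"
  have "Cauchy (\<lambda>k. l2_nth (X k) i)" for i
  proof (rule metric_CauchyI)
    fix e :: real assume "e > 0"
    with X obtain M where M: "\<And>m n. m \<ge> M \<Longrightarrow> n \<ge> M \<Longrightarrow> dist (X m) (X n) < e"
      unfolding Cauchy_def by blast
    have "dist (l2_nth (X m) i) (l2_nth (X n) i) \<le> dist (X m) (X n)" for m n
      using norm_l2_nth[of "X m - X n" i] by (simp add: dist_norm)
    with M show "\<exists>M. \<forall>m\<ge>M. \<forall>n\<ge>M. dist (l2_nth (X m) i) (l2_nth (X n) i) < e"
      using le_less_trans by blast
  qed
  then have "\<exists>l. (\<lambda>k. l2_nth (X k) i) \<longlonglongrightarrow> l" for i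
    using Cauchy_convergent convergent_def by blast
  then obtain a where a: "\<And>i. (\<lambda>k. l2_nth (X k) i) \<longlonglongrightarrow> a i" by metis
  have unif: "\<exists>M. \<forall>m\<ge>M. \<forall>F. finite F \<longrightarrow> fnorm F (\<lambda>i. l2_nth (X m) i - a i) \<le> e" if "e > 0" for e
  proof -
    from X that obtain M where M: "\<And>m n. m \<ge> M \<Longrightarrow> n \<ge> M \<Longrightarrow> dist (X m) (X n) < e"
      unfolding Cauchy_def by blast
    have "fnorm F (\<lambda>i. l2_nth (X m) i - a i) \<le> e" if "m \<ge> M" "finite F" for m F
    proof (rule tendsto_upperbound)
      show "((\<lambda>n. fnorm F (\<lambda>i. l2_nth (X m) i - l2_nth (X n) i)) \<longlongrightarrow> fnorm F (\<lambda>i. l2_nth (X m) i - a i)) sequentially"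
        unfolding fnorm_def fip_def
        by (intro tendsto_intros a bounded_linear.tendsto[OF bounded_linear_star])
      show "eventually (\<lambda>n. fnorm F (\<lambda>i. l2_nth (X m) i - l2_nth (X n) i) \<le> e) sequentially"
        using eventually_ge_at_top[of M]
      proof eventually_elim
        case (elim n)
        then show ?case
          using fnorm_le_norm[OF that(2), of "X m - X n"] M[OF that(1), of n] by (simp add: dist_norm)
      qed
    qed simp
    then show ?thesis by blast
  qed
  have al: "a \<in> l2_seq"
    unfolding l2_seq_iff_tails
  proof (intro allI impI)
    fix e :: real assume "e > 0"
    then have e: "e / 2 > 0" by simp
    from unif[OF this] obtain M where M: "\<And>F. finite F \<Longrightarrow> fnorm F (\<lambda>i. l2_nth (X M) i - a i) \<le> e / 2" by blast
    obtain N where N: "\<And>m n. m \<ge> N \<Longrightarrow> fnorm {m..<n} (l2_nth (X M)) < e / 2"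
      using l2_seq_tails[OF l2_nth_seq e] by blast
    have "fnorm {m..<n} a < e" if "m \<ge> N" for m n
    proof -
      have eq: "a = (\<lambda>i. l2_nth (X M) i + - (l2_nth (X M) i - a i))" by simp
      have "fnorm {m..<n} (\<lambda>i. - (l2_nth (X M) i - a i)) = fnorm {m..<n} (\<lambda>i. l2_nth (X M) i - a i)"
        by (simp only: fnorm_def fip_def star_minus minus_mult_minus)
      then show ?thesis
        using fnorm_add[of "{m..<n}" "l2_nth (X M)" "\<lambda>i. - (l2_nth (X M) i - a i)"]
          N[OF that, of n] M[of "{m..<n}"] by (subst eq) simp
    qed
    then show "\<exists>N. \<forall>m\<ge>N. \<forall>n. fnorm {m..<n} a < e" by blast
  qed
  define A where "A = Abs_l2 a"
  have A: "l2_nth A = a" unfolding A_def using al by (simp add: Abs_l2_inverse l2_seq_def)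
  have "X \<longlonglongrightarrow> A"
  proof (rule LIMSEQ_I)
    fix e :: real assume "e > 0"
    then have "e / 2 > 0" by simp
    from unif[OF this] obtain M where
      M: "\<And>m F. m \<ge> M \<Longrightarrow> finite F \<Longrightarrow> fnorm F (\<lambda>i. l2_nth (X m) i - a i) \<le> e / 2" by blast
    have "norm (X m - A) < e" if "m \<ge> M" for m
    proof -
      have "norm (X m - A) \<le> e / 2"
      proof (rule LIMSEQ_le_const2[OF fnorm_LIMSEQ])
        show "\<exists>N. \<forall>n\<ge>N. fnorm {..<n} (l2_nth (X m - A)) \<le> e / 2"
          using M[OF that] by (simp add: A)
      qed
      then show ?thesis using \<open>e > 0\<close> by simp
    qed
    then show "\<exists>M. \<forall>m\<ge>M. norm (X m - A) < e" by blast
  qed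
  then show "convergent X" unfolding convergent_def by blast
qed

lift_definition single_l2 :: "nat \<Rightarrow> 'b::cstar_algebra_1 \<Rightarrow> 'b l2" is
  "\<lambda>i b j. if j = i then b else 0"
proof -
  fix i and b :: 'b
  show "summable (\<lambda>j. star (if j = i then b else 0) * (if j = i then b else 0))"
    by (rule summable_finite[of "{i}"]) auto
qed

lemma single_l2_neq_0: "single_l2 i 1 \<noteq> (0 :: 'b::cstar_algebra_1 l2)"
proof
  assume "single_l2 i 1 = (0 :: 'b l2)"
  then have "l2_nth (single_l2 i (1::'b)) i = l2_nth 0 i" by (rule arg_cong)
  then show False by (simp add: single_l2.rep_eq)
qed

lifting_update l2.lifting
lifting_forget l2.lifting

subsection \<open>Adjointable operators\<close>

(* This type is the C*-algebra of adjointable bounded operators on l2, with the operator norm and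
   the adjoint as star; only real-linearity is imposed, but having an adjoint implies complex
   linearity and linearity over the coefficient algebra. *)
typedef (overloaded) 'b adjop =
  "{T :: 'b::cstar_algebra_1 l2 \<Rightarrow>\<^sub>L 'b l2. \<exists>S. \<forall>x y. l2_inner (T x) y = l2_inner x (S y)}"
  morphisms blinfun_of_adjop Abs_adjop
  by (rule exI[of _ 0]) (auto intro!: exI[of _ "\<lambda>_. 0"])

setup_lifting type_definition_adjop

lift_definition adjop_apply :: "'b::cstar_algebra_1 adjop \<Rightarrow> 'b l2 \<Rightarrow> 'b l2" is "blinfun_apply" .

definition adjop_adj :: "'b::cstar_algebra_1 adjop \<Rightarrow> 'b l2 \<Rightarrow> 'b l2" where
  "adjop_adj T = (THE S. \<forall>x y. l2_inner (adjop_apply T x) y = l2_inner x (S y))"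

lemma adjop_adj_eqI:
  assumes "\<And>x y. l2_inner (adjop_apply T x) y = l2_inner x (S y)"
  shows "adjop_adj T = S"
  unfolding adjop_adj_def
proof (rule the_equality)
  fix S' assume "\<forall>x y. l2_inner (adjop_apply T x) y = l2_inner x (S' y)"
  then show "S' = S" using assms by (metis l2_inner_eqI ext)
qed (use assms in blast)

lemma adjop_adj: "l2_inner (adjop_apply T x) y = l2_inner x (adjop_adj T y)"
proof -
  obtain S where S: "\<And>x y. l2_inner (adjop_apply T x) y = l2_inner x (S y)"
    by transfer blast
  show ?thesis using S adjop_adj_eqI[of T S] by simp
qed

lemma adjop_adj': "l2_inner (adjop_adj T x) y = l2_inner x (adjop_apply T y)"
  using adjop_adj[of T y x] by (metis l2_inner_star)

lemma bounded_linear_adjop_apply: "bounded_linear (adjop_apply T)"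
  by transfer (rule blinfun.bounded_linear_right)

lemma norm_adjop_adj: "norm (adjop_adj T y) \<le> norm (blinfun_of_adjop T) * norm y"
proof (cases "adjop_adj T y = 0")
  case False
  have "(norm (adjop_adj T y))\<^sup>2 = norm (l2_inner (adjop_apply T (adjop_adj T y)) y)"
    unfolding norm_l2_sq adjop_adj ..
  also have "\<dots> \<le> norm (adjop_apply T (adjop_adj T y)) * norm y"
    by (rule l2_inner_cauchy_schwarz)
  also have "\<dots> \<le> (norm (blinfun_of_adjop T) * norm (adjop_adj T y)) * norm y"
    by (intro mult_right_mono) (simp_all add: adjop_apply.rep_eq norm_blinfun)
  finally have "norm (adjop_adj T y) * norm (adjop_adj T y)
      \<le> (norm (blinfun_of_adjop T) * norm y) * norm (adjop_adj T y)"
    by (simp add: power2_eq_square ac_simps)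
  with False show ?thesis by simp
qed simp

lemma bounded_linear_adjop_adj: "bounded_linear (adjop_adj T)"
proof (rule bounded_linear_intro)
  fix x y :: "'a l2" and r :: real
  show "adjop_adj T (x + y) = adjop_adj T x + adjop_adj T y"
    by (rule l2_inner_eqI) (simp add: adjop_adj[symmetric] l2_inner_add_right)
  show "adjop_adj T (r *\<^sub>R x) = r *\<^sub>R adjop_adj T x"
    by (rule l2_inner_eqI) (simp add: adjop_adj[symmetric] l2_inner_scaleR_right)
  show "norm (adjop_adj T x) \<le> norm x * norm (blinfun_of_adjop T)"
    using norm_adjop_adj[of T x] by (simp add: mult.commute)
qed

lemma adjop_eqI: "(\<And>x. adjop_apply S x = adjop_apply T x) \<Longrightarrow> S = T"
  by transfer (rule blinfun_eqI)

definition adjop_of :: "('b l2 \<Rightarrow> 'b l2) \<Rightarrow> 'b::cstar_algebra_1 adjop" where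
  "adjop_of f = Abs_adjop (Blinfun f)"

lemma adjop_of:
  assumes "bounded_linear f" "\<And>x y. l2_inner (f x) y = l2_inner x (g y)"
  shows "blinfun_of_adjop (adjop_of f) = Blinfun f" "adjop_apply (adjop_of f) = f"
    "adjop_adj (adjop_of f) = g"
proof -
  show 1: "blinfun_of_adjop (adjop_of f) = Blinfun f"
    unfolding adjop_of_def using assms
    by (intro Abs_adjop_inverse) (auto simp: bounded_linear_Blinfun_apply)
  then show 2: "adjop_apply (adjop_of f) = f"
    using assms by (simp add: adjop_apply.rep_eq bounded_linear_Blinfun_apply)
  then show "adjop_adj (adjop_of f) = g" using assms by (intro adjop_adj_eqI) simp
qed

instantiation adjop :: (cstar_algebra_1) real_algebra_1
begin

lift_definition zero_adjop :: "'a adjop" is 0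
  by (auto intro!: exI[of _ "\<lambda>_. 0"])
lift_definition one_adjop :: "'a adjop" is id_blinfun
  by auto
lift_definition plus_adjop :: "'a adjop \<Rightarrow> 'a adjop \<Rightarrow> 'a adjop" is "(+)"
  by (force simp: plus_blinfun.rep_eq l2_inner_add_left simp flip: l2_inner_add_right)
lift_definition minus_adjop :: "'a adjop \<Rightarrow> 'a adjop \<Rightarrow> 'a adjop" is "(-)"
  by (force simp: minus_blinfun.rep_eq l2_inner_diff_left simp flip: l2_inner_diff_right)
lift_definition uminus_adjop :: "'a adjop \<Rightarrow> 'a adjop" is "uminus"
  by (force simp: uminus_blinfun.rep_eq l2_inner_minus_left simp flip: l2_inner_minus_right)
lift_definition scaleR_adjop :: "real \<Rightarrow> 'a adjop \<Rightarrow> 'a adjop" is "(*\<^sub>R)"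
  by (force simp: scaleR_blinfun.rep_eq l2_inner_scaleR_left simp flip: l2_inner_scaleR_right)
lift_definition times_adjop :: "'a adjop \<Rightarrow> 'a adjop \<Rightarrow> 'a adjop" is "(o\<^sub>L)"
  by force

lemma adjop_apply_simps:
  "adjop_apply 0 x = 0" "adjop_apply 1 x = x"
  "adjop_apply (S + T) x = adjop_apply S x + adjop_apply T x"
  "adjop_apply (S - T) x = adjop_apply S x - adjop_apply T x"
  "adjop_apply (- S) x = - adjop_apply S x"
  "adjop_apply (r *\<^sub>R S) x = r *\<^sub>R adjop_apply S x"
  "adjop_apply (S * T) x = adjop_apply S (adjop_apply T x)"
  by (transfer; simp add: blinfun.bilinear_simps)+

lemma adjop_apply_linear:
  "adjop_apply T 0 = 0" "adjop_apply T (x + y) = adjop_apply T x + adjop_apply T y"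
  "adjop_apply T (x - y) = adjop_apply T x - adjop_apply T y"
  "adjop_apply T (r *\<^sub>R x) = r *\<^sub>R adjop_apply T x"
  by (transfer; simp add: blinfun.bilinear_simps)+

instance
proof
  have "adjop_apply (0::'a adjop) (single_l2 0 1) \<noteq> adjop_apply 1 (single_l2 0 1)"
    by (simp add: adjop_apply_simps single_l2_neq_0 eq_commute[of 0])
  then show "(0::'a adjop) \<noteq> 1" by metis
qed (auto intro!: adjop_eqI simp: adjop_apply_simps adjop_apply_linear algebra_simps)

end

instantiation adjop :: (cstar_algebra_1) scaleC
begin
definition scaleC_adjop :: "complex \<Rightarrow> 'a adjop \<Rightarrow> 'a adjop" where
  "scaleC_adjop c T = adjop_of (\<lambda>x. c *\<^sub>C adjop_apply T x)"
instance ..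
end

lemma scaleC_adjop_aux:
  fixes T :: "'b::cstar_algebra_1 adjop"
  shows "bounded_linear (\<lambda>x. c *\<^sub>C adjop_apply T x)"
    "l2_inner (c *\<^sub>C adjop_apply T x) y = l2_inner x (adjop_adj T (cnj c *\<^sub>C y))"
  by (auto intro: bounded_linear_compose[OF bounded_linear_scaleC_right bounded_linear_adjop_apply]
      simp: l2_inner_scaleC_left l2_inner_scaleC_right adjop_adj[symmetric])

lemma adjop_apply_scaleC [simp]: "adjop_apply (c *\<^sub>C T) x = c *\<^sub>C adjop_apply T x"
  unfolding scaleC_adjop_def by (simp add: adjop_of(2)[OF scaleC_adjop_aux])

definition adjop_star :: "'b::cstar_algebra_1 adjop \<Rightarrow> 'b adjop" where
  "adjop_star T = adjop_of (adjop_adj T)"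

lemma adjop_apply_star: "adjop_apply (adjop_star T) = adjop_adj T"
  "adjop_adj (adjop_star T) = adjop_apply T"
  unfolding adjop_star_def using adjop_of[OF bounded_linear_adjop_adj adjop_adj'] by auto

instantiation adjop :: (cstar_algebra_1) real_normed_algebra_1
begin

lift_definition norm_adjop :: "'a adjop \<Rightarrow> real" is norm .
definition sgn_adjop :: "'a adjop \<Rightarrow> 'a adjop" where "sgn_adjop a = inverse (norm a) *\<^sub>R a"
definition dist_adjop :: "'a adjop \<Rightarrow> 'a adjop \<Rightarrow> real" where "dist_adjop a b = norm (a - b)"
definition uniformity_adjop :: "('a adjop \<times> 'a adjop) filter" where
  "uniformity_adjop = (INF e\<in>{0<..}. principal {(x, y). dist x y < e})"
definition open_adjop :: "'a adjop set \<Rightarrow> bool" where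
  "open_adjop U = (\<forall>x\<in>U. eventually (\<lambda>(x', y). x' = x \<longrightarrow> y \<in> U) uniformity)"

lemma norm_adjop_apply: "norm (adjop_apply T x) \<le> norm T * norm x"
  by transfer (rule norm_blinfun)

lemma norm_adjop_bound: "0 \<le> b \<Longrightarrow> (\<And>x. norm (adjop_apply T x) \<le> b * norm x) \<Longrightarrow> norm T \<le> b"
  by transfer (rule norm_blinfun_bound)

instance
proof
  fix S T :: "'a adjop" and r :: real
  show "dist S T = norm (S - T)" by (simp add: dist_adjop_def)
  show "sgn S = inverse (norm S) *\<^sub>R S" by (simp add: sgn_adjop_def)
  show "norm S = 0 \<longleftrightarrow> S = 0" by transfer simp
  show "norm (S + T) \<le> norm S + norm T" by transfer (rule norm_triangle_ineq)
  show "norm (r *\<^sub>R S) = \<bar>r\<bar> * norm S" by transfer simp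
  show "norm (S * T) \<le> norm S * norm T" by transfer (rule norm_blinfun_compose)
  show "norm (1 :: 'a adjop) = 1"
  proof (rule antisym)
    show "norm (1 :: 'a adjop) \<le> 1" by (rule norm_adjop_bound) (auto simp: adjop_apply_simps)
    show "1 \<le> norm (1 :: 'a adjop)"
      using norm_adjop_apply[of "1 :: 'a adjop" "single_l2 0 1"]
      by (simp add: adjop_apply_simps single_l2_neq_0)
  qed
qed (fact uniformity_adjop_def open_adjop_def)+

end

lemma norm_adjop_star_le: "norm (adjop_star T) \<le> norm T"
  using norm_adjop_adj[of T] by (intro norm_adjop_bound) (auto simp: adjop_apply_star norm_adjop.rep_eq)

lemma adjop_star_diff: "adjop_star (S - T) = adjop_star S - adjop_star T"
  by (rule adjop_eqI)
    (auto simp: adjop_apply_star adjop_apply_simps intro!: l2_inner_eqI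
      simp: adjop_adj[symmetric] l2_inner_diff_right l2_inner_diff_left)

instance adjop :: (cstar_algebra_1) banach
proof
  fix X :: "nat \<Rightarrow> 'a adjop" assume X: "Cauchy X"
  have d: "dist (blinfun_of_adjop S) (blinfun_of_adjop T) = dist S T" for S T :: "'a adjop"
    unfolding dist_norm by transfer simp
  have "Cauchy (\<lambda>n. blinfun_of_adjop (X n))"
    using X unfolding Cauchy_def d .
  then obtain L where L: "(\<lambda>n. blinfun_of_adjop (X n)) \<longlonglongrightarrow> L"
    using Cauchy_convergent convergent_def by blast
  have "Cauchy (\<lambda>n. blinfun_of_adjop (adjop_star (X n)))"
    unfolding Cauchy_def d
  proof (intro allI impI)
    fix e :: real assume "e > 0"
    with X obtain M where M: "\<And>m n. m \<ge> M \<Longrightarrow> n \<ge> M \<Longrightarrow> dist (X m) (X n) < e"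
      unfolding Cauchy_def by blast
    have "dist (adjop_star (X m)) (adjop_star (X n)) \<le> dist (X m) (X n)" for m n
      unfolding dist_norm adjop_star_diff[symmetric] by (rule norm_adjop_star_le)
    with M show "\<exists>M. \<forall>m\<ge>M. \<forall>n\<ge>M. dist (adjop_star (X m)) (adjop_star (X n)) < e"
      using le_less_trans by blast
  qed
  then obtain K where K: "(\<lambda>n. blinfun_of_adjop (adjop_star (X n))) \<longlonglongrightarrow> K"
    using Cauchy_convergent convergent_def by blast
  have "l2_inner (blinfun_apply L x) y = l2_inner x (blinfun_apply K y)" for x y
  proof (rule LIMSEQ_unique)
    show "(\<lambda>n. l2_inner (adjop_apply (X n) x) y) \<longlonglongrightarrow> l2_inner (blinfun_apply L x) y"
      unfolding adjop_apply.rep_eq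
      by (intro bounded_bilinear.tendsto[OF bounded_bilinear_l2_inner] tendsto_const
          bounded_bilinear.tendsto[OF bounded_bilinear_blinfun_apply] L)
    have "(\<lambda>n. l2_inner x (adjop_apply (adjop_star (X n)) y)) \<longlonglongrightarrow> l2_inner x (blinfun_apply K y)"
      unfolding adjop_apply.rep_eq
      by (intro bounded_bilinear.tendsto[OF bounded_bilinear_l2_inner] tendsto_const
          bounded_bilinear.tendsto[OF bounded_bilinear_blinfun_apply] K)
    then show "(\<lambda>n. l2_inner (adjop_apply (X n) x) y) \<longlonglongrightarrow> l2_inner x (blinfun_apply K y)"
      by (simp add: adjop_apply_star adjop_adj)
  qed
  then have A: "blinfun_of_adjop (Abs_adjop L) = L" by (intro Abs_adjop_inverse) blast
  have "X \<longlonglongrightarrow> Abs_adjop L"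
    using L unfolding tendsto_iff by (simp add: A d[symmetric])
  then show "convergent X" unfolding convergent_def by blast
qed

instantiation adjop :: (cstar_algebra_1) cstar_algebra_1
begin

definition star_adjop :: "'a adjop \<Rightarrow> 'a adjop" where "star_adjop = adjop_star"

instance
proof
  fix c d :: complex and S T :: "'a adjop" and r :: real
  show "c *\<^sub>C (S + T) = c *\<^sub>C S + c *\<^sub>C T"
    by (rule adjop_eqI) (simp add: adjop_apply_simps scaleC_add_right)
  show "(c + d) *\<^sub>C S = c *\<^sub>C S + d *\<^sub>C S"
    by (rule adjop_eqI) (simp add: adjop_apply_simps scaleC_add_left)
  show "c *\<^sub>C d *\<^sub>C S = (c * d) *\<^sub>C S"
    by (rule adjop_eqI) (simp add: adjop_apply_simps scaleC_scaleC)
  show "r *\<^sub>R S = complex_of_real r *\<^sub>C S"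
    by (rule adjop_eqI) (simp add: adjop_apply_simps scaleR_scaleC)
  show nc: "norm (c *\<^sub>C S) = cmod c * norm S" for c
  proof -
    have le: "norm (c *\<^sub>C S) \<le> cmod c * norm S" for c and S :: "'a adjop"
      by (rule norm_adjop_bound) (auto simp: norm_scaleC mult.assoc intro!: mult_left_mono norm_adjop_apply)
    show ?thesis
    proof (cases "c = 0")
      case False
      have "inverse c *\<^sub>C c *\<^sub>C S = S"
        using False by (intro adjop_eqI) (simp add: scaleC_scaleC scaleC_of_real[of 1, simplified])
      then have "norm S \<le> cmod (inverse c) * norm (c *\<^sub>C S)" using le[of "inverse c" "c *\<^sub>C S"] by simp
      then have "cmod c * norm S \<le> norm (c *\<^sub>C S)" using False by (simp add: norm_divide field_simps)
      with le[of c S] show ?thesis by simp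
    qed (use le[of 0 S] in simp)
  qed
  show "(c *\<^sub>C S) * T = c *\<^sub>C (S * T)"
    by (rule adjop_eqI) (simp add: adjop_apply_simps)
  have lin: "adjop_apply S (c *\<^sub>C x) = c *\<^sub>C adjop_apply S x" for x
    by (rule l2_inner_eqI) (simp add: adjop_adj'[symmetric] l2_inner_scaleC_right)
  show "S * (c *\<^sub>C T) = c *\<^sub>C (S * T)"
    by (rule adjop_eqI) (simp add: adjop_apply_simps lin)
  show "star (S + T) = star S + star T"
    by (rule adjop_eqI) (auto simp: star_adjop_def adjop_apply_star adjop_apply_simps intro!: l2_inner_eqI
      simp: adjop_adj[symmetric] l2_inner_add_right l2_inner_add_left)
  show "star (c *\<^sub>C S) = cnj c *\<^sub>C star S"
    by (rule adjop_eqI) (auto simp: star_adjop_def adjop_apply_star adjop_apply_simps intro!: l2_inner_eqI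
      simp: adjop_adj[symmetric] l2_inner_scaleC_right l2_inner_scaleC_left)
  show "star (S * T) = star T * star S"
    by (rule adjop_eqI) (auto simp: star_adjop_def adjop_apply_star adjop_apply_simps intro!: l2_inner_eqI
      simp: adjop_adj[symmetric])
  show ss: "star (star S) = S"
    by (rule adjop_eqI) (simp add: star_adjop_def adjop_apply_star)
  show "norm (star S * S) = (norm S)\<^sup>2"
  proof (rule antisym)
    have "norm (star S * S) \<le> norm (star S) * norm S" by (rule norm_mult_ineq)
    also have "\<dots> \<le> norm S * norm S"
      by (intro mult_right_mono) (auto simp: star_adjop_def norm_adjop_star_le)
    finally show "norm (star S * S) \<le> (norm S)\<^sup>2" by (simp add: power2_eq_square)
    have "norm S \<le> sqrt (norm (star S * S))"
    proof (rule norm_adjop_bound)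
      fix x
      have "(norm (adjop_apply S x))\<^sup>2 = norm (l2_inner (adjop_apply (star S * S) x) x)"
        by (simp add: norm_l2_sq adjop_apply_simps star_adjop_def adjop_apply_star adjop_adj')
      also have "\<dots> \<le> norm (adjop_apply (star S * S) x) * norm x"
        by (rule l2_inner_cauchy_schwarz)
      also have "\<dots> \<le> (norm (star S * S) * norm x) * norm x"
        by (intro mult_right_mono norm_adjop_apply) simp
      also have "\<dots> = (sqrt (norm (star S * S)) * norm x)\<^sup>2"
        by (simp add: power_mult_distrib power2_eq_square)
      finally show "norm (adjop_apply S x) \<le> sqrt (norm (star S * S)) * norm x"
        by (rule power2_le_imp_le) simp
    qed simp
    then show "(norm S)\<^sup>2 \<le> norm (star S * S)"
      using power_mono[of "norm S" "sqrt (norm (star S * S))" 2] by simp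
  qed
qed

end

lemma l2_inner_star_adjop: "l2_inner (adjop_apply T x) y = l2_inner x (adjop_apply (star T) y)"
  by (simp add: star_adjop_def adjop_apply_star adjop_adj)

subsection \<open>Extended holomorphic curves\<close>

definition dz :: "(complex \<Rightarrow> 'a::complex_normed_vector) \<Rightarrow> complex \<Rightarrow> 'a" where
  "dz f z = (1/2) *\<^sub>C (frechet_derivative f (at z) 1 - \<i> *\<^sub>C frechet_derivative f (at z) \<i>)"

definition dzbar :: "(complex \<Rightarrow> 'a::complex_normed_vector) \<Rightarrow> complex \<Rightarrow> 'a" where
  "dzbar f z = (1/2) *\<^sub>C (frechet_derivative f (at z) 1 + \<i> *\<^sub>C frechet_derivative f (at z) \<i>)"

definition holomorphic_map_on ::
    "(complex \<Rightarrow> 'a::complex_normed_vector) \<Rightarrow> complex set \<Rightarrow> bool" where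
  "holomorphic_map_on f \<Omega> \<longleftrightarrow> (\<forall>z\<in>\<Omega>. \<exists>D. (f has_derivative (\<lambda>h. h *\<^sub>C D)) (at z within \<Omega>))"

(* Local expansion into a power series in the two real coordinates of z - z0. On an infinite
   index set has_sum is unconditional convergence, here in norm. *)
definition real_analytic_map_on ::
    "(complex \<Rightarrow> 'a::real_normed_vector) \<Rightarrow> complex set \<Rightarrow> bool" where
  "real_analytic_map_on f \<Omega> \<longleftrightarrow>
    (\<forall>z0\<in>\<Omega>. \<exists>r>0. \<exists>c :: nat \<Rightarrow> nat \<Rightarrow> 'a. \<forall>z \<in> ball z0 r \<inter> \<Omega>.
      ((\<lambda>(i, j). (Re (z - z0) ^ i * Im (z - z0) ^ j) *\<^sub>R c i j) has_sum f z) UNIV)"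

definition ext_hol_curve :: "complex set \<Rightarrow> (complex \<Rightarrow> 'u::cstar_algebra_1) \<Rightarrow> bool" where
  "ext_hol_curve \<Omega> I \<longleftrightarrow>
    real_analytic_map_on I \<Omega> \<and>
    (\<forall>z\<in>\<Omega>. I z * I z = I z \<and>
      dzbar I z = I z * dzbar I z \<and> dz I z = dz I z * I z \<and>
      dzbar I z * I z = 0 \<and> I z * dz I z = 0)"

definition tuple_inner :: "'b^'n \<Rightarrow> 'b^'n::finite \<Rightarrow> 'b::cstar_algebra_1" where
  "tuple_inner v w = (\<Sum>i\<in>UNIV. star (w $ i) * v $ i)"

definition tuple_op :: "('n::finite \<Rightarrow> 'b l2) \<Rightarrow> 'b^'n \<Rightarrow> 'b::cstar_algebra_1 l2" where
  "tuple_op a w = (\<Sum>i\<in>UNIV. a i \<bullet>\<^sub>B (w $ i))"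

definition tuple_adjoint ::
    "('b^'n::finite \<Rightarrow> 'b l2) \<Rightarrow> 'b l2 \<Rightarrow> 'b::cstar_algebra_1^'n" where
  "tuple_adjoint T = (THE S. \<forall>w x. l2_inner (T w) x = tuple_inner w (S x))"

lemma l2_inner_sum_left: "l2_inner (sum f A) b = (\<Sum>i\<in>A. l2_inner (f i) b)"
  by (induction A rule: infinite_finite_induct) (auto simp: l2_inner_add_left)

lemma tuple_inner_axis: "tuple_inner (axis i 1) v = star (v $ i)"
proof -
  have "tuple_inner (axis i 1) v = (\<Sum>j\<in>UNIV. if j = i then star (v $ j) else 0)"
    unfolding tuple_inner_def axis_def by (rule sum.cong) auto
  then show ?thesis by simp
qed

lemma tuple_inner_eqI:
  assumes "\<And>w. tuple_inner w u = tuple_inner w v"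
  shows "u = v"
  using assms[of "axis _ 1"] unfolding vec_eq_iff tuple_inner_axis by (metis star_star)

lemma tuple_op_adjoint:
  "l2_inner (tuple_op a w) x = tuple_inner w (\<chi> i. l2_inner x (a i))"
  by (simp add: tuple_op_def tuple_inner_def l2_inner_sum_left l2_inner_rmult_left l2_inner_star)

lemma tuple_adjoint_tuple_op: "tuple_adjoint (tuple_op a) x = (\<chi> i. l2_inner x (a i))"
proof -
  have "tuple_adjoint (tuple_op a) = (\<lambda>x. \<chi> i. l2_inner x (a i))"
    unfolding tuple_adjoint_def
  proof (rule the_equality)
    fix S assume "\<forall>w x. l2_inner (tuple_op a w) x = tuple_inner w (S x)"
    then show "S = (\<lambda>x. \<chi> i. l2_inner x (a i))"
      by (intro ext tuple_inner_eqI) (simp flip: tuple_op_adjoint)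
  qed (simp add: tuple_op_adjoint)
  then show ?thesis by simp
qed

lemma l2_rmult_one_zero [simp]: "a \<bullet>\<^sub>B 1 = a" "a \<bullet>\<^sub>B 0 = 0"
  by (auto intro!: l2_eqI)

lemma tuple_op_axis: "tuple_op a (axis i 1) = a i"
proof -
  have "tuple_op a (axis i 1) = (\<Sum>j\<in>UNIV. if j = i then a j else 0)"
    unfolding tuple_op_def axis_def by (rule sum.cong) auto
  then show ?thesis by simp
qed

(* The n x n matrix of the operator \<beta>* \<alpha> on n-tuples. *)
definition gram :: "('n::finite \<Rightarrow> 'b l2) \<Rightarrow> ('n \<Rightarrow> 'b l2) \<Rightarrow> 'b::cstar_algebra_1^'n^'n" where
  "gram a b = matrix (tuple_adjoint (tuple_op b) \<circ> tuple_op a)"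

lemma gram_nth: "gram a b $ i $ j = l2_inner (a j) (b i)"
  by (simp add: gram_def matrix_def tuple_op_axis tuple_adjoint_tuple_op)

lemma gram_mult_vector: "gram a b *v w = tuple_adjoint (tuple_op b) (tuple_op a w)"
  by (simp add: vec_eq_iff matrix_vector_mult_def gram_nth tuple_adjoint_tuple_op)
    (simp add: tuple_op_def l2_inner_sum_left l2_inner_rmult_left)

(* The positive integer n of the class is the cardinality of the finite index type. *)
definition curve_class ::
    "'n::finite itself \<Rightarrow> complex set \<Rightarrow> (complex \<Rightarrow> 'b::cstar_algebra_1 adjop) set" where
  "curve_class TYPE('n) \<Omega> = {I. ext_hol_curve \<Omega> I \<and>
    (\<exists>\<alpha> \<beta> :: complex \<Rightarrow> 'n \<Rightarrow> 'b l2.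
      (\<forall>i. holomorphic_map_on (\<lambda>z. \<alpha> z i) \<Omega> \<and> holomorphic_map_on (\<lambda>z. \<beta> z i) \<Omega>) \<and>
      (\<forall>z\<in>\<Omega>. invertible (gram (\<alpha> z) (\<beta> z)) \<and>
        (\<forall>x. adjop_apply (I z) x =
          tuple_op (\<alpha> z) (matrix_inv (gram (\<alpha> z) (\<beta> z)) *v tuple_adjoint (tuple_op (\<beta> z)) x))))}"

fun ext_curvature :: "(complex \<Rightarrow> 'u::cstar_algebra_1) \<Rightarrow> nat \<Rightarrow> nat \<Rightarrow> complex \<Rightarrow> 'u" where
  "ext_curvature I 0 0 = (\<lambda>z. dzbar I z * dz I z)"
| "ext_curvature I (Suc i) 0 = (\<lambda>z. I z * dz (ext_curvature I i 0) z)"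
| "ext_curvature I i (Suc j) = (\<lambda>z. dzbar (ext_curvature I i j) z * I z)"

definition invertible_elem :: "'u::monoid_mult \<Rightarrow> bool" where
  "invertible_elem X \<longleftrightarrow> (\<exists>Y. X * Y = 1 \<and> Y * X = 1)"

definition similar_curves ::
    "complex set \<Rightarrow> (complex \<Rightarrow> 'u::cstar_algebra_1) \<Rightarrow> (complex \<Rightarrow> 'u) \<Rightarrow> bool" where
  "similar_curves \<Omega> I J \<longleftrightarrow> (\<exists>X. invertible_elem X \<and> (\<forall>z\<in>\<Omega>. X * I z = J z * X))"

end

(*
  Differentiating I (dz I) = 0 and dzbar I = I (dzbar I) gives
  dz (dzbar I) = dzbar (dz I) = (dz I) (dzbar I) - (dzbar I) (dz I). Hence the algebra generated by
  the pure derivatives dz^i I and dzbar^j I is closed under dz and dzbar: it contains all mixed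
  derivatives and all curvatures, and each is given by the same noncommutative polynomial for every
  curve. Since (dz^i I) I = dz^i I and I (dzbar^j I) = dzbar^j I, condition (ii) with j = 0 or i = 0
  says that X intertwines the pure derivatives of I and J at z0. Then X intertwines all mixed
  derivatives at z0, so X I - J X vanishes there to infinite order, and by real analyticity
  X I = J X on the connected set. The operator X at z0 itself is therefore a similarity.
*)
theory Submission
  imports Defs
begin

section \<open>Real-analytic maps of two real variables\<close>

text \<open>The algebra lives with \<open>dz\<close> and \<open>dzbar\<close>, while analyticity is
  given by unconditional series in two real coordinates. Hence vanishing to infinite order is
  expressed by iterated derivatives in the directions \<open>1\<close> and \<open>\<i>\<close>,
  closure of the algebra by Wirtinger derivatives, and linear combinations translate between the
  two. The definition of analyticity supplies an expansion at every point of \<Omega>, so no series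
  has to be re-expanded about a second centre. Products of analytic maps are never shown to be
  analytic: a polynomial in derivatives is differentiated by the product rule, for which
  differentiability is enough, and X I - J X is analytic as a sum of bounded linear images of I and
  J. Closure of the algebra is circular at first sight, since the \<open>dzbar\<close>-derivative of
  \<open>(dz ^^ n) I\<close> is a mixed derivative of high order; commuting the two operators turns
  it into iterated \<open>dz\<close>-derivatives of the commutator formula for order one.\<close>

definition directional_deriv :: "complex \<Rightarrow> (complex \<Rightarrow> 'a::real_normed_vector) \<Rightarrow> complex \<Rightarrow> 'a" where
  "directional_deriv v f z = frechet_derivative f (at z) v"

text \<open>A single local expansion with its centre, radius and coefficients exposed, so that
  derivatives can be tracked through their coefficients.\<close>

definition double_power_series ::
    "(complex \<Rightarrow> 'a::real_normed_vector) \<Rightarrow> complex \<Rightarrow> real \<Rightarrow> (nat \<Rightarrow> nat \<Rightarrow> 'a) \<Rightarrow> bool" where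
  "double_power_series f z0 r c \<longleftrightarrow> r > 0 \<and>
    (\<forall>z\<in>ball z0 r. ((\<lambda>(i, j). (Re (z - z0) ^ i * Im (z - z0) ^ j) *\<^sub>R c i j) has_sum f z) UNIV)"

section \<open>Coefficient bounds and termwise differentiation of double power series\<close>

text \<open>The terms of a convergent series are bounded, so one evaluation where both coordinates
  are \<open>r / 2\<close> controls all coefficients. That point has distance r / sqrt 2 from the
  centre and lies in the ball.\<close>

lemma double_power_series_coeff_bound:
  fixes f :: "complex \<Rightarrow> 'a::real_normed_vector"
  assumes "double_power_series f z0 r c"
  obtains M where "M \<ge> 0" "\<And>i j. norm (c i j) * (r / 2) ^ (i + j) \<le> M"
proof -
  define z where "z = z0 + Complex (r / 2) (r / 2)"
  have r: "r > 0" using assms by (simp add: double_power_series_def)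
  have "cmod (Complex (r / 2) (r / 2)) < r"
    unfolding cmod_def using r by (intro real_less_lsqrt) (auto simp: power2_eq_square)
  then have "z \<in> ball z0 r"
    by (simp add: z_def dist_norm norm_minus_commute)
  then have "((\<lambda>(i, j). (Re (z - z0) ^ i * Im (z - z0) ^ j) *\<^sub>R c i j) has_sum f z) UNIV"
    using assms by (auto simp: double_power_series_def)
  then have "((\<lambda>n. case prod_decode n of (i, j) \<Rightarrow> ((r / 2) ^ (i + j)) *\<^sub>R c i j) has_sum f z) UNIV"
    by (subst has_sum_reindex_bij_betw[OF bij_prod_decode]) (simp add: z_def power_add)
  then have "(\<lambda>n. case prod_decode n of (i, j) \<Rightarrow> ((r / 2) ^ (i + j)) *\<^sub>R c i j) \<longlonglongrightarrow> 0"
    by (intro summable_LIMSEQ_zero) (auto dest!: has_sum_imp_sums simp: summable_def)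
  then have "Bseq (\<lambda>n. case prod_decode n of (i, j) \<Rightarrow> ((r / 2) ^ (i + j)) *\<^sub>R c i j)"
    by (intro convergent_imp_Bseq) (auto simp: convergent_def)
  then obtain M where M: "M > 0"
    "\<And>n. norm (case prod_decode n of (i, j) \<Rightarrow> ((r / 2) ^ (i + j)) *\<^sub>R c i j) \<le> M"
    by (auto simp: Bseq_def)
  have "norm (c i j) * (r / 2) ^ (i + j) \<le> M" for i j
    using M(2)[of "prod_encode (i, j)"] r by (simp add: mult.commute)
  with M(1) show ?thesis by (intro that[of M]) auto
qed

text \<open>Supplies the majorants of the Weierstrass test: products of one-variable series, listed
  in the order in which \<open>prod_decode\<close> runs through the index pairs.\<close>

lemma summable_prod_decode:
  fixes f g :: "nat \<Rightarrow> real"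
  assumes "\<And>n. f n \<ge> 0" "\<And>n. g n \<ge> 0" "summable f" "summable g"
  shows "summable (\<lambda>n. case prod_decode n of (i, j) \<Rightarrow> f i * g j)"
proof -
  have "((\<lambda>j. f i * g j) has_sum f i * suminf g) UNIV" for i
    using assms by (intro has_sum_cmult_right norm_summable_imp_has_sum) auto
  moreover have "(\<lambda>i. f i * suminf g) summable_on UNIV"
    using assms by (intro summable_on_cmult_left norm_summable_imp_summable_on) auto
  ultimately have "(\<lambda>(i, j). f i * g j) summable_on (SIGMA i:UNIV. UNIV)"
    using assms by (intro summable_on_SigmaI) auto
  then have "(\<lambda>(i, j). f i * g j) summable_on UNIV" by simp
  then have "(\<lambda>n. case prod_decode n of (i, j) \<Rightarrow> f i * g j) summable_on UNIV"
    by (subst summable_on_reindex_bij_betw[OF bij_prod_decode])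
  then show ?thesis by (auto simp: summable_on_def summable_def dest: has_sum_imp_sums)
qed

lemma summable_index_half_power: "summable (\<lambda>i. real i * (1/2) ^ (i - 1))"
proof -
  have "summable (\<lambda>n. diffs (\<lambda>_. 1::real) n * (1/2) ^ n)"
    by (rule termdiff_converges[of _ 1]) (auto intro: summable_geometric)
  then have "summable (\<lambda>n. real (Suc n) * (1/2) ^ (Suc n - 1))" by (simp add: diffs_def)
  then show ?thesis by (subst (asm) summable_Suc_iff)
qed

text \<open>The terms with \<open>i = 0\<close> vanish through the factor \<open>real i\<close>, so
  the sum lives on the range of \<open>Suc\<close> in the first index, and the truncated exponent
  \<open>0 - 1\<close> does no harm.\<close>

lemma double_power_series_shift:
  fixes c :: "nat \<Rightarrow> nat \<Rightarrow> 'a::real_normed_vector"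
  assumes "((\<lambda>(i, j). (real i * x ^ (i - 1) * y ^ j) *\<^sub>R c i j) has_sum s) UNIV"
  shows "((\<lambda>(i, j). (x ^ i * y ^ j) *\<^sub>R (real (Suc i) *\<^sub>R c (Suc i) j)) has_sum s) UNIV"
proof -
  let ?h = "\<lambda>(i, j). (Suc i, j :: nat)"
  have "((\<lambda>(i, j). (real i * x ^ (i - 1) * y ^ j) *\<^sub>R c i j) has_sum s) (range ?h)"
    using assms
  proof (rule has_sum_cong_neutral[THEN iffD1, rotated -1])
    fix p :: "nat \<times> nat" assume "p \<in> UNIV - range ?h"
    then have "fst p = 0" by (cases p; cases "fst p") (auto simp: image_iff)
    then show "(case p of (i, j) \<Rightarrow> (real i * x ^ (i - 1) * y ^ j) *\<^sub>R c i j) = 0"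
      by (auto simp: case_prod_unfold)
  qed auto
  then have "((\<lambda>(i, j). (real i * x ^ (i - 1) * y ^ j) *\<^sub>R c i j) \<circ> ?h has_sum s) UNIV"
    by (subst (asm) has_sum_reindex) (auto simp: inj_on_def)
  then show ?thesis by (simp add: o_def case_prod_unfold mult_ac del: of_nat_Suc)
qed

text \<open>Exchanging the two summation indices reduces this to the shift in the first one.\<close>

lemma double_power_series_shift':
  fixes c :: "nat \<Rightarrow> nat \<Rightarrow> 'a::real_normed_vector"
  assumes "((\<lambda>(i, j). (real j * x ^ i * y ^ (j - 1)) *\<^sub>R c i j) has_sum s) UNIV"
  shows "((\<lambda>(i, j). (x ^ i * y ^ j) *\<^sub>R (real (Suc j) *\<^sub>R c i (Suc j))) has_sum s) UNIV"
proof -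
  have swap: "((\<lambda>(j, i). g i j) has_sum s) UNIV \<longleftrightarrow> ((\<lambda>(i, j). g i j) has_sum s) UNIV"
    for g :: "nat \<Rightarrow> nat \<Rightarrow> 'a"
    using has_sum_reindex_bij_betw[OF bij_swap, of "\<lambda>(i, j). g i j" s]
    by (simp add: case_prod_unfold)
  show ?thesis
    using double_power_series_shift[of y x "\<lambda>j i. c i j" s] assms
    unfolding swap[of "\<lambda>i j. (real j * x ^ i * y ^ (j - 1)) *\<^sub>R c i j", symmetric]
      swap[of "\<lambda>i j. (x ^ i * y ^ j) *\<^sub>R (real (Suc j) *\<^sub>R c i (Suc j))", symmetric]
    by (simp add: mult_ac del: of_nat_Suc)
qed

theorem double_power_series_derivative:
  fixes f :: "complex \<Rightarrow> 'a::banach"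
  assumes "double_power_series f z0 r c"
  obtains \<rho> where "\<And>z. z \<in> ball z0 \<rho> \<Longrightarrow> f differentiable at z"
    "double_power_series (directional_deriv 1 f) z0 \<rho> (\<lambda>i j. real (Suc i) *\<^sub>R c (Suc i) j)"
    "double_power_series (directional_deriv \<i> f) z0 \<rho> (\<lambda>i j. real (Suc j) *\<^sub>R c i (Suc j))"
proof -
  have r: "r > 0" using assms by (simp add: double_power_series_def)
  obtain M where M: "M \<ge> 0" "\<And>i j. norm (c i j) * (r / 2) ^ (i + j) \<le> M"
    using double_power_series_coeff_bound[OF assms] by blast
  \<comment> \<open>The coefficients decay like \<open>M / (2 * \<rho>) ^ (i + j)\<close>, so
    coordinates of size at most \<open>\<rho>\<close> leave a factor 1/2 for each power; this makes
    the differentiated series converge uniformly.\<close>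
  define \<rho> where "\<rho> = r / 4"
  have \<rho>: "\<rho> > 0" "\<rho> \<le> r" "r / 2 = 2 * \<rho>" using r by (auto simp: \<rho>_def)
  define S where "S = ball z0 \<rho>"
  have S: "convex S" "open S" "z0 \<in> S" "S \<subseteq> ball z0 r"
    using \<rho> by (auto simp: S_def)
  define t where "t = (\<lambda>n z. case prod_decode n of (i, j) \<Rightarrow> (Re (z - z0) ^ i * Im (z - z0) ^ j) *\<^sub>R c i j)"
  define p where "p = (\<lambda>n z. case prod_decode n of (i, j) \<Rightarrow>
    (real i * Re (z - z0) ^ (i - 1) * Im (z - z0) ^ j) *\<^sub>R c i j)"
  define q where "q = (\<lambda>n z. case prod_decode n of (i, j) \<Rightarrow>
    (real j * Re (z - z0) ^ i * Im (z - z0) ^ (j - 1)) *\<^sub>R c i j)"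
  define N1 where "N1 = (\<lambda>n. case prod_decode n of (i, j) \<Rightarrow> (M / \<rho>) * ((real i * (1/2) ^ (i - 1)) * (1/2) ^ j))"
  define N2 where "N2 = (\<lambda>n. case prod_decode n of (i, j) \<Rightarrow> (M / \<rho>) * ((1/2) ^ i * (real j * (1/2) ^ (j - 1))))"
  have N1: "summable N1"
    using summable_mult[OF summable_prod_decode[OF _ _ summable_index_half_power, of "\<lambda>j. (1/2) ^ j"], of "M / \<rho>"]
    by (simp add: N1_def case_prod_unfold)
  have N2: "summable N2"
    using summable_mult[OF summable_prod_decode[OF _ _ _ summable_index_half_power, of "\<lambda>j. (1/2) ^ j"], of "M / \<rho>"]
    by (simp add: N2_def case_prod_unfold)
  \<comment> \<open>Only the total degree of the coefficient enters, so its indices are kept apart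
    from the exponents. With the coordinates exchanged the same bound then covers
    \<open>q\<close>.\<close>
  have bound: "real i * \<bar>x\<bar> ^ (i - 1) * \<bar>y\<bar> ^ j * norm (c i' j') \<le> (M / \<rho>) * (real i * (1/2) ^ (i - 1) * (1/2) ^ j)"
    if xy: "\<bar>x\<bar> \<le> \<rho>" "\<bar>y\<bar> \<le> \<rho>" and eq: "i' + j' = i + j" for x y i j i' j'
  proof (cases i)
    case (Suc k)
    have c: "norm (c i' j') \<le> M / (2 * \<rho>) ^ (i + j)"
      using M(2)[of i' j'] \<rho> eq by (simp add: pos_le_divide_eq)
    have "\<bar>x\<bar> ^ k * \<bar>y\<bar> ^ j \<le> \<rho> ^ k * \<rho> ^ j"
      using xy \<rho> by (intro mult_mono power_mono) auto
    from mult_mono[OF this c] have "\<bar>x\<bar> ^ k * \<bar>y\<bar> ^ j * norm (c i' j') \<le> \<rho> ^ k * \<rho> ^ j * (M / (2 * \<rho>) ^ (i + j))"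
      using \<rho> by simp
    also have "\<dots> = M / \<rho> * ((1/2) ^ i * (1/2) ^ j)"
      using \<rho> by (simp add: Suc power_add power_mult_distrib field_simps)
    also have "\<dots> \<le> M / \<rho> * ((1/2) ^ k * (1/2) ^ j)"
      using \<rho> M(1) by (intro mult_left_mono mult_right_mono) (auto simp: Suc)
    finally have "real i * (\<bar>x\<bar> ^ k * \<bar>y\<bar> ^ j * norm (c i' j')) \<le> real i * (M / \<rho> * ((1/2) ^ k * (1/2) ^ j))"
      by (rule mult_left_mono) simp
    then show ?thesis by (simp only: Suc diff_Suc_1 mult_ac)
  qed simp
  have xy: "\<bar>Re (z - z0)\<bar> \<le> \<rho>" "\<bar>Im (z - z0)\<bar> \<le> \<rho>" if "z \<in> S" for z
    using that abs_Re_le_cmod[of "z - z0"] abs_Im_le_cmod[of "z - z0"]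
    by (auto simp: S_def dist_norm norm_minus_commute)
  have p: "norm (p n z) \<le> N1 n" if "z \<in> S" for n z
    using bound[OF xy[OF that], of "fst (prod_decode n)" "snd (prod_decode n)"]
    by (auto simp: p_def N1_def case_prod_unfold abs_mult power_abs)
  have q: "norm (q n z) \<le> N2 n" if "z \<in> S" for n z
    using bound[OF xy(2)[OF that] xy(1)[OF that], of "fst (prod_decode n)" "snd (prod_decode n)" "snd (prod_decode n)" "fst (prod_decode n)"]
    by (auto simp: q_def N2_def case_prod_unfold abs_mult power_abs mult_ac)
  define P where "P = (\<lambda>z. \<Sum>n. p n z)"
  define Q where "Q = (\<lambda>z. \<Sum>n. q n z)"
  have uP: "uniform_limit S (\<lambda>n z. \<Sum>i<n. p i z) P sequentially"
    unfolding P_def by (rule Weierstrass_m_test[OF p N1])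
  have uQ: "uniform_limit S (\<lambda>n z. \<Sum>i<n. q i z) Q sequentially"
    unfolding Q_def by (rule Weierstrass_m_test[OF q N2])
  have sums_f: "(\<lambda>n. t n z) sums f z" if "z \<in> S" for z
  proof -
    have "((\<lambda>(i, j). (Re (z - z0) ^ i * Im (z - z0) ^ j) *\<^sub>R c i j) has_sum f z) UNIV"
      using assms S that by (auto simp: double_power_series_def)
    then show ?thesis
      by (subst (asm) has_sum_reindex_bij_betw[OF bij_prod_decode, symmetric])
        (auto simp: t_def dest: has_sum_imp_sums)
  qed
  \<comment> \<open>Termwise differentiation needs the partial sums to converge uniformly as linear
    maps in \<open>h\<close>; each of the limits \<open>P\<close> and \<open>Q\<close> is allowed
    half of the error.\<close>
  have "\<exists>g. \<forall>z\<in>S. (\<lambda>n. t n z) sums g z \<and> (g has_derivative (\<lambda>h. Re h *\<^sub>R P z + Im h *\<^sub>R Q z)) (at z within S)"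
  proof (rule has_derivative_series[where S = S and f = t and x = z0 and l = "f z0"
          and f' = "\<lambda>n z h. Re h *\<^sub>R p n z + Im h *\<^sub>R q n z"])
    show "convex S" "z0 \<in> S" "(\<lambda>n. t n z0) sums f z0" using S(1,3) sums_f by auto
  next
    fix n z
    obtain i j where ij: "prod_decode n = (i, j)" by (cases "prod_decode n")
    show "(t n has_derivative (\<lambda>h. Re h *\<^sub>R p n z + Im h *\<^sub>R q n z)) (at z within S)"
      unfolding t_def p_def q_def ij prod.case
      by (auto intro!: derivative_eq_intros simp: algebra_simps)
  next
    fix e :: real assume "e > 0"
    then have e: "e / 2 > 0" by simp
    from uniform_limitD[OF uP e] uniform_limitD[OF uQ e]
    show "\<forall>\<^sub>F n in sequentially. \<forall>z\<in>S. \<forall>h. norm ((\<Sum>i<n. Re h *\<^sub>R p i z + Im h *\<^sub>R q i z)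
      - (Re h *\<^sub>R P z + Im h *\<^sub>R Q z)) \<le> e * norm h"
    proof eventually_elim
      case (elim n)
      show ?case
      proof (intro ballI allI)
        fix z h assume z: "z \<in> S"
        have "(\<Sum>i<n. Re h *\<^sub>R p i z + Im h *\<^sub>R q i z) - (Re h *\<^sub>R P z + Im h *\<^sub>R Q z)
          = Re h *\<^sub>R ((\<Sum>i<n. p i z) - P z) + Im h *\<^sub>R ((\<Sum>i<n. q i z) - Q z)"
          by (simp add: sum.distrib scaleR_sum_right scaleR_diff_right)
        also have "norm \<dots> \<le> \<bar>Re h\<bar> * norm ((\<Sum>i<n. p i z) - P z) + \<bar>Im h\<bar> * norm ((\<Sum>i<n. q i z) - Q z)"
          using norm_triangle_ineq[of "Re h *\<^sub>R ((\<Sum>i<n. p i z) - P z)" "Im h *\<^sub>R ((\<Sum>i<n. q i z) - Q z)"] by simp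
        also have "\<dots> \<le> norm h * (e / 2) + norm h * (e / 2)"
          using elim z by (intro add_mono mult_mono abs_Re_le_cmod abs_Im_le_cmod) (auto simp: dist_norm less_imp_le)
        finally show "norm ((\<Sum>i<n. Re h *\<^sub>R p i z + Im h *\<^sub>R q i z) - (Re h *\<^sub>R P z + Im h *\<^sub>R Q z)) \<le> e * norm h"
          by (simp add: mult_ac)
      qed
    qed
  qed
  then obtain g where g: "\<And>z. z \<in> S \<Longrightarrow> (\<lambda>n. t n z) sums g z"
    "\<And>z. z \<in> S \<Longrightarrow> (g has_derivative (\<lambda>h. Re h *\<^sub>R P z + Im h *\<^sub>R Q z)) (at z)"
    using S(2) at_within_open[OF _ S(2)] by auto
  have gf: "g z = f z" if "z \<in> S" for z
    using g(1)[OF that] sums_f[OF that] by (rule sums_unique2)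
  have D: "(f has_derivative (\<lambda>h. Re h *\<^sub>R P z + Im h *\<^sub>R Q z)) (at z)" if "z \<in> S" for z
    using has_derivative_transform_within_open[OF g(2)[OF that] S(2) that] gf by blast
  have dP: "directional_deriv 1 f z = P z" and dQ: "directional_deriv \<i> f z = Q z" if "z \<in> S" for z
    using frechet_derivative_at[OF D[OF that], symmetric] by (simp_all add: directional_deriv_def)
  \<comment> \<open>The majorant gives absolute summability, which turns the enumerated series back
    into the unconditional sum over index pairs.\<close>
  have hsP: "((\<lambda>(i, j). (Re (z - z0) ^ i * Im (z - z0) ^ j) *\<^sub>R (real (Suc i) *\<^sub>R c (Suc i) j)) has_sum P z) UNIV"
    if "z \<in> S" for z
  proof -
    have sn: "summable (\<lambda>n. norm (p n z))"
      by (rule summable_comparison_test'[OF N1, of 0]) (use p[OF that] in auto)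
    then have "((\<lambda>n. p n z) has_sum P z) UNIV"
      unfolding P_def by (rule norm_summable_imp_has_sum[OF _ summable_sums[OF summable_norm_cancel[OF sn]]])
    then show ?thesis
      unfolding p_def by (subst (asm) has_sum_reindex_bij_betw[OF bij_prod_decode]) (rule double_power_series_shift)
  qed
  have hsQ: "((\<lambda>(i, j). (Re (z - z0) ^ i * Im (z - z0) ^ j) *\<^sub>R (real (Suc j) *\<^sub>R c i (Suc j))) has_sum Q z) UNIV"
    if "z \<in> S" for z
  proof -
    have sn: "summable (\<lambda>n. norm (q n z))"
      by (rule summable_comparison_test'[OF N2, of 0]) (use q[OF that] in auto)
    then have "((\<lambda>n. q n z) has_sum Q z) UNIV"
      unfolding Q_def by (rule norm_summable_imp_has_sum[OF _ summable_sums[OF summable_norm_cancel[OF sn]]])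
    then show ?thesis
      unfolding q_def by (subst (asm) has_sum_reindex_bij_betw[OF bij_prod_decode]) (rule double_power_series_shift')
  qed
  show thesis
  proof
    show "f differentiable at z" if "z \<in> ball z0 \<rho>" for z
      using D that unfolding S_def differentiable_def by blast
  next
    show "double_power_series (directional_deriv 1 f) z0 \<rho> (\<lambda>i j. real (Suc i) *\<^sub>R c (Suc i) j)"
      using hsP \<rho> dP unfolding double_power_series_def S_def[symmetric] by simp
    show "double_power_series (directional_deriv \<i> f) z0 \<rho> (\<lambda>i j. real (Suc j) *\<^sub>R c i (Suc j))"
      using hsQ \<rho> dQ unfolding double_power_series_def S_def[symmetric] by simp
  qed
qed


section \<open>Rules for directional derivatives\<close>

lemma directional_deriv_cong:
  assumes "open \<Omega>" "z \<in> \<Omega>" "f differentiable at z" "\<And>w. w \<in> \<Omega> \<Longrightarrow> f w = g w"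
  shows "directional_deriv v f z = directional_deriv v g z"
  using frechet_derivative_transform_within_open[OF assms(3,1,2,4)] by (simp add: directional_deriv_def)

lemma differentiable_bounded_linear:
  assumes "bounded_linear L" "f differentiable at z"
  shows "(\<lambda>z. L (f z)) differentiable at z"
  using assms bounded_linear.has_derivative unfolding differentiable_def by blast

lemma directional_deriv_bounded_linear:
  assumes "bounded_linear L" "f differentiable at z"
  shows "directional_deriv v (\<lambda>z. L (f z)) z = L (directional_deriv v f z)"
proof -
  have "((\<lambda>z. L (f z)) has_derivative (\<lambda>h. L (frechet_derivative f (at z) h))) (at z)"
    using assms bounded_linear.has_derivative frechet_derivative_works by blast
  from frechet_derivative_at[OF this, symmetric] show ?thesis by (simp add: directional_deriv_def)
qed

lemma directional_deriv_add:
  assumes "f differentiable at z" "g differentiable at z"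
  shows "directional_deriv v (\<lambda>z. f z + g z) z = directional_deriv v f z + directional_deriv v g z"
  using frechet_derivative_at[OF has_derivative_add[OF assms[unfolded frechet_derivative_works]], symmetric]
  by (simp add: directional_deriv_def)

lemma directional_deriv_mult:
  fixes f g :: "complex \<Rightarrow> 'a::real_normed_algebra"
  assumes "f differentiable at z" "g differentiable at z"
  shows "directional_deriv v (\<lambda>z. f z * g z) z = directional_deriv v f z * g z + f z * directional_deriv v g z"
  using frechet_derivative_at[OF has_derivative_mult[OF assms[unfolded frechet_derivative_works]], symmetric]
  by (simp add: directional_deriv_def)

section \<open>Real-analytic maps: derivatives and closure properties\<close>

text \<open>Since \<open>0 ^ 0 = 1\<close>, the index \<open>(0, 0)\<close> is the only one that
  survives at the centre.\<close>

lemma double_power_series_center: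
  assumes "double_power_series f z0 r c"
  shows "f z0 = c 0 0"
proof -
  have "((\<lambda>(i, j). (Re (z0 - z0) ^ i * Im (z0 - z0) ^ j) *\<^sub>R c i j) has_sum f z0) UNIV"
    using assms by (auto simp only: double_power_series_def centre_in_ball)
  then have "((\<lambda>(i, j). (0 ^ i * 0 ^ j) *\<^sub>R c i j) has_sum f z0) UNIV" by simp
  then have "((\<lambda>(i, j). (0 ^ i * 0 ^ j) *\<^sub>R c i j) has_sum f z0) {(0, 0)}"
    by (rule has_sum_cong_neutral[THEN iffD1, rotated -1]) (auto simp: power_0_left split: if_splits)
  moreover have "((\<lambda>(i, j). (0 ^ i * 0 ^ j) *\<^sub>R c i j) has_sum c 0 0) {(0, 0)}"
    using has_sum_finite[of "{(0, 0)}" "\<lambda>(i, j). (0 ^ i * 0 ^ j) *\<^sub>R c i j"] by simp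
  ultimately show ?thesis by (rule has_sum_unique)
qed

lemma real_analytic_imp_double_power_series:
  assumes "real_analytic_map_on f \<Omega>" "open \<Omega>" "z0 \<in> \<Omega>"
  obtains r c where "double_power_series f z0 r c" "ball z0 r \<subseteq> \<Omega>"
proof -
  obtain r1 c where r1: "r1 > 0" "\<forall>z \<in> ball z0 r1 \<inter> \<Omega>.
      ((\<lambda>(i, j). (Re (z - z0) ^ i * Im (z - z0) ^ j) *\<^sub>R c i j) has_sum f z) UNIV"
    using assms unfolding real_analytic_map_on_def by blast
  obtain r2 where r2: "r2 > 0" "ball z0 r2 \<subseteq> \<Omega>"
    using assms(2,3) open_contains_ball by blast
  show thesis
  proof
    have "z \<in> ball z0 r1 \<inter> \<Omega>" if "z \<in> ball z0 (min r1 r2)" for z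
      using that r2(2) by auto
    with r1 r2(1) show "double_power_series f z0 (min r1 r2) c"
      unfolding double_power_series_def min_less_iff_conj by blast
    show "ball z0 (min r1 r2) \<subseteq> \<Omega>" using r2(2) by auto
  qed
qed

lemma double_power_series_imp_real_analytic:
  assumes "\<And>z0. z0 \<in> \<Omega> \<Longrightarrow> \<exists>r c. double_power_series f z0 r c"
  shows "real_analytic_map_on f \<Omega>"
  unfolding real_analytic_map_on_def
proof
  fix z0 assume "z0 \<in> \<Omega>"
  from assms[OF this] obtain r c where "double_power_series f z0 r c" by blast
  then show "\<exists>r>0. \<exists>c. \<forall>z\<in>ball z0 r \<inter> \<Omega>.
      ((\<lambda>(i, j). (Re (z - z0) ^ i * Im (z - z0) ^ j) *\<^sub>R c i j) has_sum f z) UNIV"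
    unfolding double_power_series_def by (intro exI[of _ r] conjI exI[of _ c] ballI) blast+
qed

lemma real_analytic_differentiable:
  fixes f :: "complex \<Rightarrow> 'a::banach"
  assumes "real_analytic_map_on f \<Omega>" "open \<Omega>" "z \<in> \<Omega>"
  shows "f differentiable at z"
proof -
  obtain r c where "double_power_series f z r c"
    using real_analytic_imp_double_power_series[OF assms] by blast
  then show ?thesis
  proof (rule double_power_series_derivative)
    fix \<rho>
    assume "\<And>w. w \<in> ball z \<rho> \<Longrightarrow> f differentiable at w"
      and "double_power_series (directional_deriv 1 f) z \<rho> (\<lambda>i j. real (Suc i) *\<^sub>R c (Suc i) j)"
    then show ?thesis by (simp add: double_power_series_def)
  qed
qed

lemma real_analytic_directional_deriv:
  fixes f :: "complex \<Rightarrow> 'a::banach"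
  assumes "real_analytic_map_on f \<Omega>" "open \<Omega>"
  shows "real_analytic_map_on (directional_deriv 1 f) \<Omega>"
    and "real_analytic_map_on (directional_deriv \<i> f) \<Omega>"
proof -
  have "(\<exists>r c. double_power_series (directional_deriv 1 f) z0 r c) \<and>
      (\<exists>r c. double_power_series (directional_deriv \<i> f) z0 r c)" if "z0 \<in> \<Omega>" for z0
  proof -
    obtain r c where "double_power_series f z0 r c"
      using real_analytic_imp_double_power_series[OF assms \<open>z0 \<in> \<Omega>\<close>] by blast
    then show ?thesis
      by (rule double_power_series_derivative) (intro conjI exI; assumption)
  qed
  then show "real_analytic_map_on (directional_deriv 1 f) \<Omega>"
    "real_analytic_map_on (directional_deriv \<i> f) \<Omega>"
    by (auto intro!: double_power_series_imp_real_analytic)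
qed

text \<open>With the expansion centred at \<open>z\<close> itself, either order of differentiation
  reads off the coefficient \<open>c 1 1\<close>.\<close>

lemma directional_deriv_commute:
  fixes f :: "complex \<Rightarrow> 'a::banach"
  assumes "real_analytic_map_on f \<Omega>" "open \<Omega>" "z \<in> \<Omega>"
  shows "directional_deriv 1 (directional_deriv \<i> f) z = directional_deriv \<i> (directional_deriv 1 f) z"
proof -
  obtain r c where "double_power_series f z r c"
    using real_analytic_imp_double_power_series[OF assms] by blast
  then show ?thesis
  proof (rule double_power_series_derivative)
    fix \<rho>
    assume x: "double_power_series (directional_deriv 1 f) z \<rho> (\<lambda>i j. real (Suc i) *\<^sub>R c (Suc i) j)"
      and y: "double_power_series (directional_deriv \<i> f) z \<rho> (\<lambda>i j. real (Suc j) *\<^sub>R c i (Suc j))"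
    from x have "directional_deriv \<i> (directional_deriv 1 f) z = c 1 1"
    proof (rule double_power_series_derivative)
      fix \<sigma>
      assume "double_power_series (directional_deriv \<i> (directional_deriv 1 f)) z \<sigma>
        (\<lambda>i j. real (Suc j) *\<^sub>R real (Suc i) *\<^sub>R c (Suc i) (Suc j))"
      from double_power_series_center[OF this] show ?thesis by simp
    qed
    moreover from y have "directional_deriv 1 (directional_deriv \<i> f) z = c 1 1"
    proof (rule double_power_series_derivative)
      fix \<sigma>
      assume "double_power_series (directional_deriv 1 (directional_deriv \<i> f)) z \<sigma>
        (\<lambda>i j. real (Suc i) *\<^sub>R real (Suc j) *\<^sub>R c (Suc i) (Suc j))"
      from double_power_series_center[OF this] show ?thesis by simp
    qed
    ultimately show ?thesis by simp
  qed
qed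

lemma real_analytic_bounded_linear:
  assumes "bounded_linear L" "real_analytic_map_on f \<Omega>"
  shows "real_analytic_map_on (\<lambda>z. L (f z)) \<Omega>"
  unfolding real_analytic_map_on_def
proof
  fix z0 assume "z0 \<in> \<Omega>"
  with assms(2) obtain r c where r: "r > 0" "\<forall>z \<in> ball z0 r \<inter> \<Omega>.
      ((\<lambda>(i, j). (Re (z - z0) ^ i * Im (z - z0) ^ j) *\<^sub>R c i j) has_sum f z) UNIV"
    unfolding real_analytic_map_on_def by blast
  have "((\<lambda>(i, j). (Re (z - z0) ^ i * Im (z - z0) ^ j) *\<^sub>R L (c i j)) has_sum L (f z)) UNIV"
    if "z \<in> ball z0 r \<inter> \<Omega>" for z
    using has_sum_bounded_linear[OF assms(1) r(2)[rule_format, OF that]]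
    by (simp add: o_def case_prod_unfold linear_simps[OF assms(1)])
  with r(1) show "\<exists>r>0. \<exists>c. \<forall>z \<in> ball z0 r \<inter> \<Omega>.
      ((\<lambda>(i, j). (Re (z - z0) ^ i * Im (z - z0) ^ j) *\<^sub>R c i j) has_sum L (f z)) UNIV"
    by (intro exI[of _ r] conjI exI[of _ "\<lambda>i j. L (c i j)"]) auto
qed

lemma real_analytic_add:
  assumes "real_analytic_map_on f \<Omega>" "real_analytic_map_on g \<Omega>"
  shows "real_analytic_map_on (\<lambda>z. f z + g z) \<Omega>"
  unfolding real_analytic_map_on_def
proof
  fix z0 assume z0: "z0 \<in> \<Omega>"
  from assms(1) z0 obtain r c where r: "r > 0" "\<forall>z \<in> ball z0 r \<inter> \<Omega>.
      ((\<lambda>(i, j). (Re (z - z0) ^ i * Im (z - z0) ^ j) *\<^sub>R c i j) has_sum f z) UNIV"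
    unfolding real_analytic_map_on_def by blast
  from assms(2) z0 obtain s d where s: "s > 0" "\<forall>z \<in> ball z0 s \<inter> \<Omega>.
      ((\<lambda>(i, j). (Re (z - z0) ^ i * Im (z - z0) ^ j) *\<^sub>R d i j) has_sum g z) UNIV"
    unfolding real_analytic_map_on_def by blast
  have "((\<lambda>(i, j). (Re (z - z0) ^ i * Im (z - z0) ^ j) *\<^sub>R (c i j + d i j)) has_sum f z + g z) UNIV"
    if "z \<in> ball z0 (min r s) \<inter> \<Omega>" for z
    using has_sum_add[OF r(2)[rule_format] s(2)[rule_format], of z z] that
    by (simp add: case_prod_unfold scaleR_add_right)
  with r(1) s(1) show "\<exists>r>0. \<exists>c. \<forall>z \<in> ball z0 r \<inter> \<Omega>.
      ((\<lambda>(i, j). (Re (z - z0) ^ i * Im (z - z0) ^ j) *\<^sub>R c i j) has_sum f z + g z) UNIV"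
    by (intro exI[of _ "min r s"] conjI exI[of _ "\<lambda>i j. c i j + d i j"]) auto
qed

section \<open>The identity theorem\<close>

text \<open>Words in the two directions, in any order: vanishing to infinite order can be stated and
  proved by induction without normalising mixed derivatives.\<close>

inductive_set partial_derivs :: "(complex \<Rightarrow> 'a::real_normed_vector) \<Rightarrow> (complex \<Rightarrow> 'a) set" for f where
  self: "f \<in> partial_derivs f"
| re: "g \<in> partial_derivs f \<Longrightarrow> directional_deriv 1 g \<in> partial_derivs f"
| im: "g \<in> partial_derivs f \<Longrightarrow> directional_deriv \<i> g \<in> partial_derivs f"

lemma partial_derivs_trans: "h \<in> partial_derivs g \<Longrightarrow> g \<in> partial_derivs f \<Longrightarrow> h \<in> partial_derivs f"
  by (induction rule: partial_derivs.induct) (auto intro: partial_derivs.intros)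

lemma real_analytic_partial_derivs:
  fixes f :: "complex \<Rightarrow> 'a::banach"
  assumes "real_analytic_map_on f \<Omega>" "open \<Omega>" "g \<in> partial_derivs f"
  shows "real_analytic_map_on g \<Omega>"
  using assms(3) by induction (use assms real_analytic_directional_deriv in auto)

text \<open>A derivative in a suitable direction shifts the coefficient to lower total degree and
  multiplies it by a nonzero integer; its own iterated derivatives are among those of
  \<open>f\<close>, so the induction runs over all \<open>f\<close>.\<close>

lemma double_power_series_coeff_eq_0:
  fixes f :: "complex \<Rightarrow> 'a::banach"
  assumes "double_power_series f z0 r c" "\<And>g. g \<in> partial_derivs f \<Longrightarrow> g z0 = 0"
  shows "c i j = 0"
  using assms
proof (induction "i + j" arbitrary: f r c i j)
  case 0
  have "f z0 = 0" by (rule 0(3)) (rule partial_derivs.self)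
  then show ?case using 0(1) double_power_series_center[OF 0(2)] by simp
next
  case (Suc n)
  have vanish: "g z0 = 0" if "g \<in> partial_derivs h" "h \<in> partial_derivs f" for g h
    using Suc.prems(2) partial_derivs_trans that by blast
  from Suc.prems(1) show ?case
  proof (rule double_power_series_derivative)
    fix \<rho>
    assume x: "double_power_series (directional_deriv 1 f) z0 \<rho> (\<lambda>i j. real (Suc i) *\<^sub>R c (Suc i) j)"
      and y: "double_power_series (directional_deriv \<i> f) z0 \<rho> (\<lambda>i j. real (Suc j) *\<^sub>R c i (Suc j))"
    show ?case
    proof (cases i)
      case (Suc k)
      have "real (Suc k) *\<^sub>R c (Suc k) j = 0"
        by (rule Suc.hyps(1)[of k j "directional_deriv 1 f" \<rho>, OF _ x])
          (use Suc.hyps(2) Suc vanish partial_derivs.re[OF partial_derivs.self] in auto)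
      then show ?thesis using Suc by simp
    next
      case 0
      then obtain k where k: "j = Suc k" using Suc.hyps(2) by (cases j) auto
      have "real (Suc k) *\<^sub>R c i (Suc k) = 0"
        by (rule Suc.hyps(1)[of i k "directional_deriv \<i> f" \<rho>, OF _ y])
          (use Suc.hyps(2) k vanish partial_derivs.im[OF partial_derivs.self] in auto)
      then show ?thesis using k by simp
    qed
  qed
qed

lemma partial_derivs_locally_zero:
  fixes f :: "complex \<Rightarrow> 'a::real_normed_vector"
  assumes "g \<in> partial_derivs f" "open U" "\<And>z. z \<in> U \<Longrightarrow> f z = 0" "z \<in> U"
  shows "g z = 0"
proof -
  have zero: "directional_deriv v h z = 0" if "\<And>z. z \<in> U \<Longrightarrow> h z = 0" "z \<in> U"
    for h :: "complex \<Rightarrow> 'a" and z v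
    using directional_deriv_cong[OF assms(2) that(2), of "\<lambda>_. 0" h] that
    by (simp add: directional_deriv_def)
  show ?thesis
    using assms(1,4) by (induction arbitrary: z) (simp_all add: assms(3) zero)
qed

theorem real_analytic_identity:
  fixes f :: "complex \<Rightarrow> 'a::banach"
  assumes "real_analytic_map_on f \<Omega>" "open \<Omega>" "connected \<Omega>" "z0 \<in> \<Omega>"
    and "\<And>g. g \<in> partial_derivs f \<Longrightarrow> g z0 = 0" and "z \<in> \<Omega>"
  shows "f z = 0"
proof -
  \<comment> \<open>The common zero set of all derivatives is open as well as closed; the zero set
    of \<open>f\<close> alone need not be open.\<close>
  define Z where "Z = {z \<in> \<Omega>. \<forall>g\<in>partial_derivs f. g z = 0}"
  have "openin (top_of_set \<Omega>) Z"
    unfolding openin_open_eq[OF assms(2)]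
  proof
    show "open Z"
    proof (rule openI)
      fix w assume w: "w \<in> Z"
      then obtain r c where rc: "double_power_series f w r c" "ball w r \<subseteq> \<Omega>"
        using real_analytic_imp_double_power_series[OF assms(1,2)] by (auto simp: Z_def)
      \<comment> \<open>At a point of \<open>Z\<close> the whole expansion is zero, so
        \<open>f\<close> and then all its derivatives vanish on the ball.\<close>
      have "c i j = 0" for i j
        by (rule double_power_series_coeff_eq_0[OF rc(1)]) (use w in \<open>auto simp: Z_def\<close>)
      then have "((\<lambda>_. 0) has_sum f u) (UNIV :: (nat \<times> nat) set)" if "u \<in> ball w r" for u
        using rc(1) that by (simp add: double_power_series_def case_prod_unfold)
      then have "f u = 0" if "u \<in> ball w r" for u
        using that has_sum_unique has_sum_0_simp by blast
      then have "g u = 0" if "u \<in> ball w r" "g \<in> partial_derivs f" for g u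
        using partial_derivs_locally_zero[OF that(2) open_ball _ that(1)] by blast
      then have "ball w r \<subseteq> Z" using rc(2) by (auto simp: Z_def)
      then show "\<exists>e>0. ball w e \<subseteq> Z" using rc(1) by (auto simp: double_power_series_def)
    qed
  qed (auto simp: Z_def)
  moreover have "closedin (top_of_set \<Omega>) Z"
  proof -
    have "closedin (top_of_set \<Omega>) {z \<in> \<Omega>. g z = 0}" if "g \<in> partial_derivs f" for g
    proof (rule continuous_closedin_preimage_constant)
      have "g differentiable at u" if "u \<in> \<Omega>" for u
        using real_analytic_differentiable[OF real_analytic_partial_derivs[OF assms(1,2)] assms(2) that]
          \<open>g \<in> partial_derivs f\<close> by blast
      then show "continuous_on \<Omega> g"
        by (metis continuous_at_imp_continuous_on differentiable_imp_continuous_within)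
    qed
    then have "closedin (top_of_set \<Omega>) (\<Inter>g\<in>partial_derivs f. {z \<in> \<Omega>. g z = 0})"
      using partial_derivs.self by (intro closedin_INT) auto
    moreover have "Z = (\<Inter>g\<in>partial_derivs f. {z \<in> \<Omega>. g z = 0})"
      using partial_derivs.self by (auto simp: Z_def)
    ultimately show ?thesis by simp
  qed
  moreover have "z0 \<in> Z" using assms(4,5) by (auto simp: Z_def)
  ultimately have "Z = \<Omega>"
    using assms(3) unfolding connected_clopen by blast
  with \<open>z \<in> \<Omega>\<close> show ?thesis using partial_derivs.self by (auto simp: Z_def)
qed
section \<open>Wirtinger derivatives\<close>

text \<open>The parameter \<open>k\<close> is \<open>\<i>\<close> for \<open>dz\<close> and \<open>-\<i>\<close> for \<open>dzbar\<close>, so that both are treated at once.\<close>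

definition wirtinger :: "complex \<Rightarrow> (complex \<Rightarrow> 'a::complex_normed_vector) \<Rightarrow> complex \<Rightarrow> 'a" where
  "wirtinger k f z = (1/2) *\<^sub>C (directional_deriv 1 f z - k *\<^sub>C directional_deriv \<i> f z)"

lemma dz_eq_wirtinger: "dz = wirtinger \<i>"
  by (simp add: dz_def wirtinger_def directional_deriv_def fun_eq_iff)

lemma dzbar_eq_wirtinger: "dzbar = wirtinger (- \<i>)"
  by (simp add: dzbar_def wirtinger_def directional_deriv_def fun_eq_iff scaleC_minus_left)

lemma scaleC_one [simp]: "1 *\<^sub>C (x::'a::complex_normed_vector) = x"
  using scaleC_of_real[of 1 x] by simp

text \<open>Carries closure under \<open>dz\<close> and \<open>dzbar\<close> over to
  \<open>partial_derivs\<close>. The difference is written with \<open>(-1) *\<^sub>C\<close> so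
  that only sums and complex multiples occur, the linear operations of
  \<open>generated\<close>.\<close>

lemma directional_deriv_wirtinger:
  fixes f :: "complex \<Rightarrow> 'a::complex_normed_vector"
  shows "directional_deriv 1 f z = wirtinger \<i> f z + wirtinger (- \<i>) f z"
    and "directional_deriv \<i> f z = \<i> *\<^sub>C (wirtinger \<i> f z + (-1) *\<^sub>C wirtinger (- \<i>) f z)"
proof -
  let ?x = "directional_deriv 1 f z" and ?y = "directional_deriv \<i> f z"
  have half: "(1/2) *\<^sub>C u + (1/2) *\<^sub>C u = u" for u :: 'a
    by (simp flip: scaleC_add_left)
  show "directional_deriv 1 f z = wirtinger \<i> f z + wirtinger (- \<i>) f z"
    by (simp add: wirtinger_def scaleC_minus_left scaleC_diff_right scaleC_add_right half)
  have "wirtinger \<i> f z + (-1) *\<^sub>C wirtinger (- \<i>) f z = - ((1/2) *\<^sub>C (\<i> *\<^sub>C ?y) + (1/2) *\<^sub>C (\<i> *\<^sub>C ?y))"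
    by (simp add: wirtinger_def scaleC_minus_left scaleC_diff_right scaleC_add_right)
  then show "directional_deriv \<i> f z = \<i> *\<^sub>C (wirtinger \<i> f z + (-1) *\<^sub>C wirtinger (- \<i>) f z)"
    by (simp add: half scaleC_minus_right scaleC_ii_ii)
qed

lemma wirtinger_cong:
  assumes "open \<Omega>" "z \<in> \<Omega>" "f differentiable at z" "\<And>w. w \<in> \<Omega> \<Longrightarrow> f w = g w"
  shows "wirtinger k f z = wirtinger k g z"
  using directional_deriv_cong[OF assms] by (simp add: wirtinger_def)

lemma wirtinger_bounded_linear:
  assumes "bounded_linear L" "\<And>c x. L (c *\<^sub>C x) = c *\<^sub>C L x" "f differentiable at z"
  shows "wirtinger k (\<lambda>z. L (f z)) z = L (wirtinger k f z)"
  by (simp add: wirtinger_def directional_deriv_bounded_linear[OF assms(1,3)] assms(2)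
      linear_simps[OF assms(1)])

lemma wirtinger_add:
  assumes "f differentiable at z" "g differentiable at z"
  shows "wirtinger k (\<lambda>z. f z + g z) z = wirtinger k f z + wirtinger k g z"
  by (simp add: wirtinger_def directional_deriv_add[OF assms] scaleC_add_right scaleC_diff_right)

lemma wirtinger_scaleC:
  assumes "f differentiable at z"
  shows "wirtinger k (\<lambda>z. a *\<^sub>C f z) z = a *\<^sub>C wirtinger k f z"
  using assms by (intro wirtinger_bounded_linear bounded_linear_scaleC_right)
    (simp_all add: scaleC_scaleC mult.commute)

lemma wirtinger_mult:
  fixes f g :: "complex \<Rightarrow> 'u::cstar_algebra_1"
  assumes "f differentiable at z" "g differentiable at z"
  shows "wirtinger k (\<lambda>z. f z * g z) z = wirtinger k f z * g z + f z * wirtinger k g z"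
  by (simp add: wirtinger_def directional_deriv_mult[OF assms] scaleC_add_right scaleC_diff_right
      scaleC_mult_left scaleC_mult_right left_diff_distrib right_diff_distrib)

lemma real_analytic_wirtinger:
  fixes f :: "complex \<Rightarrow> 'a::{banach, complex_normed_vector}"
  assumes "real_analytic_map_on f \<Omega>" "open \<Omega>"
  shows "real_analytic_map_on (wirtinger k f) \<Omega>"
proof -
  have "real_analytic_map_on
      (\<lambda>z. (1/2) *\<^sub>C (directional_deriv 1 f z + - (k *\<^sub>C directional_deriv \<i> f z))) \<Omega>"
    by (intro real_analytic_bounded_linear[OF bounded_linear_scaleC_right] real_analytic_add
        real_analytic_bounded_linear[OF bounded_linear_minus[OF bounded_linear_ident]]
        real_analytic_directional_deriv assms)
  then show ?thesis by (simp add: wirtinger_def[abs_def])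
qed

lemma real_analytic_wirtinger_funpow:
  fixes f :: "complex \<Rightarrow> 'a::{banach, complex_normed_vector}"
  assumes "real_analytic_map_on f \<Omega>" "open \<Omega>"
  shows "real_analytic_map_on ((wirtinger k ^^ n) f) \<Omega>"
  by (induction n) (use assms real_analytic_wirtinger in auto)

lemma directional_deriv_wirtinger_expand:
  fixes f :: "complex \<Rightarrow> 'a::{banach, complex_normed_vector}"
  assumes "real_analytic_map_on f \<Omega>" "open \<Omega>" "z \<in> \<Omega>"
  shows "directional_deriv v (wirtinger k f) z =
    (1/2) *\<^sub>C (directional_deriv v (directional_deriv 1 f) z
      - k *\<^sub>C directional_deriv v (directional_deriv \<i> f) z)"
proof -
  have x: "directional_deriv 1 f differentiable at z" and y: "directional_deriv \<i> f differentiable at z"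
    using real_analytic_differentiable[OF real_analytic_directional_deriv(1)[OF assms(1,2)] assms(2,3)]
      real_analytic_differentiable[OF real_analytic_directional_deriv(2)[OF assms(1,2)] assms(2,3)] by auto
  have L: "bounded_linear (\<lambda>u::'a. - (k *\<^sub>C u))"
    by (rule bounded_linear_minus[OF bounded_linear_scaleC_right])
  have Ly: "(\<lambda>z. - (k *\<^sub>C directional_deriv \<i> f z)) differentiable at z"
    using differentiable_bounded_linear[OF L y] by simp
  have "directional_deriv v (wirtinger k f) z =
      (1/2) *\<^sub>C directional_deriv v (\<lambda>z. directional_deriv 1 f z + - (k *\<^sub>C directional_deriv \<i> f z)) z"
    unfolding wirtinger_def[abs_def]
    using directional_deriv_bounded_linear[OF bounded_linear_scaleC_right differentiable_add[OF x Ly]] by simp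
  then show ?thesis
    using directional_deriv_add[OF x Ly] directional_deriv_bounded_linear[OF L y] by simp
qed

text \<open>Once the two real directions commute, the expansion into second directional derivatives
  is symmetric in \<open>k\<close> and \<open>l\<close>.\<close>

lemma wirtinger_commute:
  fixes f :: "complex \<Rightarrow> 'a::{banach, complex_normed_vector}"
  assumes "real_analytic_map_on f \<Omega>" "open \<Omega>" "z \<in> \<Omega>"
  shows "wirtinger k (wirtinger l f) z = wirtinger l (wirtinger k f) z"
  unfolding wirtinger_def[of _ "wirtinger _ f" z] directional_deriv_wirtinger_expand[OF assms]
    directional_deriv_commute[OF assms]
  by (simp add: scaleC_diff_right scaleC_scaleC mult_ac)

section \<open>Universal polynomials in the pure derivatives\<close>

text \<open>\<open>F\<close> and \<open>G\<close> arise on \<open>\<Omega>\<close> from related pairs by one and the same noncommutative polynomial;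
  pairing the two curves replaces a syntax of polynomials.\<close>

inductive generated ::
    "complex set \<Rightarrow> ((complex \<Rightarrow> 'u::cstar_algebra_1) \<Rightarrow> (complex \<Rightarrow> 'u) \<Rightarrow> bool) \<Rightarrow>
      (complex \<Rightarrow> 'u) \<Rightarrow> (complex \<Rightarrow> 'u) \<Rightarrow> bool" for \<Omega> S where
  base: "S F G \<Longrightarrow> generated \<Omega> S F G"
| add: "generated \<Omega> S F G \<Longrightarrow> generated \<Omega> S F' G' \<Longrightarrow> generated \<Omega> S (\<lambda>z. F z + F' z) (\<lambda>z. G z + G' z)"
| mult: "generated \<Omega> S F G \<Longrightarrow> generated \<Omega> S F' G' \<Longrightarrow> generated \<Omega> S (\<lambda>z. F z * F' z) (\<lambda>z. G z * G' z)"
| scaleC: "generated \<Omega> S F G \<Longrightarrow> generated \<Omega> S (\<lambda>z. a *\<^sub>C F z) (\<lambda>z. a *\<^sub>C G z)"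
| cong: "generated \<Omega> S F G \<Longrightarrow> (\<And>z. z \<in> \<Omega> \<Longrightarrow> F' z = F z) \<Longrightarrow> (\<And>z. z \<in> \<Omega> \<Longrightarrow> G' z = G z) \<Longrightarrow>
    generated \<Omega> S F' G'"

lemma generated_subset:
  assumes "generated \<Omega> S F G" "\<And>F G. S F G \<Longrightarrow> generated \<Omega> T F G"
  shows "generated \<Omega> T F G"
  using assms(1) by induction (use assms(2) in \<open>auto intro: generated.intros\<close>)

text \<open>In a product, \<open>X\<close> moves past one factor at a time.\<close>

lemma generated_intertwine:
  assumes "generated \<Omega> S F G" "\<And>F G. S F G \<Longrightarrow> X * F z = G z * X" "z \<in> \<Omega>"
  shows "X * F z = G z * X"
  using assms(1)
proof induction
  case (mult F G F' G')
  then show ?case by (metis mult.assoc)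
qed (use assms(2,3) in \<open>auto simp: algebra_simps scaleC_mult_left scaleC_mult_right\<close>)

lemma generated_differentiable:
  assumes "generated \<Omega> S F G" "\<And>F G z. S F G \<Longrightarrow> z \<in> \<Omega> \<Longrightarrow> F differentiable at z \<and> G differentiable at z"
    and "open \<Omega>" "z \<in> \<Omega>"
  shows "F differentiable at z \<and> G differentiable at z"
  using assms(1)
proof induction
  case (scaleC F G a)
  then show ?case
    using differentiable_bounded_linear[OF bounded_linear_scaleC_right] by blast
next
  case (cong F G F' G')
  have "h' differentiable at z" if "h differentiable at z" "\<And>w. w \<in> \<Omega> \<Longrightarrow> h' w = h w" for h h' :: "complex \<Rightarrow> 'a"
    using that assms(3,4) unfolding differentiable_def
    by (metis has_derivative_transform_within_open)
  with cong show ?case by blast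
qed (use assms(2,4) in \<open>auto intro: differentiable_add differentiable_mult\<close>)

text \<open>The sum and product rules reduce closure to the generators. They are applied only at
  points of \<Omega>, which is why \<open>generated\<close> admits replacing functions by others
  that agree there.\<close>

lemma generated_wirtinger:
  assumes "generated \<Omega> S F G" "open \<Omega>"
    and diff: "\<And>F G z. S F G \<Longrightarrow> z \<in> \<Omega> \<Longrightarrow> F differentiable at z \<and> G differentiable at z"
    and S: "\<And>F G. S F G \<Longrightarrow> generated \<Omega> S (wirtinger k F) (wirtinger k G)"
  shows "generated \<Omega> S (wirtinger k F) (wirtinger k G)"
  using assms(1)
proof induction
  case (add F G F' G')
  note d = add.hyps[THEN generated_differentiable, OF diff \<open>open \<Omega>\<close>]
  show ?case
    by (rule generated.cong[OF generated.add[OF add.IH]]) (use d in \<open>auto intro: wirtinger_add\<close>)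
next
  case (mult F G F' G')
  note d = mult.hyps[THEN generated_differentiable, OF diff \<open>open \<Omega>\<close>]
  show ?case
    by (rule generated.cong[OF generated.add[OF generated.mult[OF mult.IH(1) mult.hyps(2)]
          generated.mult[OF mult.hyps(1) mult.IH(2)]]]) (use d in \<open>auto intro: wirtinger_mult\<close>)
next
  case (scaleC F G a)
  note d = scaleC.hyps[THEN generated_differentiable, OF diff \<open>open \<Omega>\<close>]
  show ?case
    by (rule generated.cong[OF generated.scaleC[OF scaleC.IH]]) (use d in \<open>auto intro: wirtinger_scaleC\<close>)
next
  case (cong F G F' G')
  note d = cong.hyps(1)[THEN generated_differentiable, OF diff \<open>open \<Omega>\<close>]
  show ?case
    by (rule generated.cong[OF cong.IH]) (use d cong.hyps in \<open>auto intro: wirtinger_cong[symmetric, OF \<open>open \<Omega>\<close>]\<close>)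
qed (rule S)

section \<open>Derivatives of one extended holomorphic curve\<close>

context
  fixes \<Omega> :: "complex set"
  assumes \<Omega>: "open \<Omega>"
begin

lemma ext_hol_curve_mixed_deriv:
  assumes "ext_hol_curve \<Omega> I" "z \<in> \<Omega>"
  shows "dz (dzbar I) z = dz I z * dzbar I z - dzbar I z * dz I z"
    and "dzbar (dz I) z = dz I z * dzbar I z - dzbar I z * dz I z"
proof -
  have ra: "real_analytic_map_on I \<Omega>" using assms by (simp add: ext_hol_curve_def)
  note diff = real_analytic_differentiable[OF _ \<Omega> assms(2)]
  have dI: "I differentiable at z" "dz I differentiable at z" "dzbar I differentiable at z"
    unfolding dz_eq_wirtinger dzbar_eq_wirtinger
    by (intro diff real_analytic_wirtinger ra \<Omega>)+
  have comm: "dz (dzbar I) z = dzbar (dz I) z"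
    unfolding dz_eq_wirtinger dzbar_eq_wirtinger by (rule wirtinger_commute[OF ra \<Omega> assms(2)])
  have "dzbar (\<lambda>w. I w * dz I w) z = dzbar (\<lambda>_. 0) z"
    unfolding dzbar_eq_wirtinger
    by (rule wirtinger_cong[OF \<Omega> assms(2) differentiable_mult[OF dI(1,2)]])
      (use assms(1) in \<open>simp add: ext_hol_curve_def\<close>)
  also have "\<dots> = 0" by (simp add: dzbar_def)
  finally have 1: "dzbar I z * dz I z + I z * dzbar (dz I) z = 0"
    unfolding dzbar_eq_wirtinger by (simp add: wirtinger_mult[OF dI(1,2)])
  have "dz (dzbar I) z = dz (\<lambda>w. I w * dzbar I w) z"
    unfolding dz_eq_wirtinger
    by (rule wirtinger_cong[OF \<Omega> assms(2) dI(3)]) (use assms(1) in \<open>simp add: ext_hol_curve_def\<close>)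
  also have "\<dots> = dz I z * dzbar I z + I z * dz (dzbar I) z"
    unfolding dz_eq_wirtinger by (rule wirtinger_mult[OF dI(1,3)])
  finally have 2: "dz (dzbar I) z = dz I z * dzbar I z + I z * dz (dzbar I) z" .
  \<comment> \<open>Fact \<open>1\<close> determines \<open>I z\<close> times the mixed derivative,
    which is the only term to be eliminated from \<open>2\<close>.\<close>
  show "dz (dzbar I) z = dz I z * dzbar I z - dzbar I z * dz I z"
    using 1 2 unfolding comm by (metis add_eq_0_iff uminus_add_conv_diff add.commute)
  then show "dzbar (dz I) z = dz I z * dzbar I z - dzbar I z * dz I z"
    by (simp add: comm)
qed

text \<open>Differentiating the identity of order \<open>n\<close> leaves the extra term
  \<open>(dz ^^ n) I z * dz I z\<close>. The same identity inserts a factor \<open>I z\<close> in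
  the middle, and \<open>I z * dz I z = 0\<close> kills it; the other side is symmetric, with
  \<open>dzbar I z * I z = 0\<close>.\<close>

lemma ext_hol_curve_pure_deriv:
  assumes "ext_hol_curve \<Omega> I" "z \<in> \<Omega>"
  shows "(dz ^^ n) I z * I z = (dz ^^ n) I z" and "I z * (dzbar ^^ n) I z = (dzbar ^^ n) I z"
proof -
  have ra: "real_analytic_map_on I \<Omega>" using assms by (simp add: ext_hol_curve_def)
  have dI: "(dz ^^ n) I differentiable at z" "(dzbar ^^ n) I differentiable at z" if "z \<in> \<Omega>" for n z
    unfolding dz_eq_wirtinger dzbar_eq_wirtinger
    by (intro real_analytic_differentiable[OF _ \<Omega> that] real_analytic_wirtinger_funpow ra \<Omega>)+
  have I: "I w * I w = I w" "dzbar I w * I w = 0" "I w * dz I w = 0" if "w \<in> \<Omega>" for w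
    using assms(1) that unfolding ext_hol_curve_def by blast+
  show "(dz ^^ n) I z * I z = (dz ^^ n) I z"
    using assms(2)
  proof (induction n arbitrary: z)
    case (Suc n)
    have "dz ((dz ^^ n) I) z = dz (\<lambda>w. (dz ^^ n) I w * I w) z"
      unfolding dz_eq_wirtinger
      by (rule wirtinger_cong[OF \<Omega> Suc.prems dI(1)[OF Suc.prems, unfolded dz_eq_wirtinger]])
        (use Suc.IH in \<open>simp add: dz_eq_wirtinger\<close>)
    also have "\<dots> = dz ((dz ^^ n) I) z * I z + (dz ^^ n) I z * dz I z"
      using wirtinger_mult[OF dI(1)[OF Suc.prems] dI(1)[OF Suc.prems, of 0]]
      by (simp add: dz_eq_wirtinger)
    also have "(dz ^^ n) I z * dz I z = (dz ^^ n) I z * (I z * dz I z)"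
      by (metis Suc.IH[OF Suc.prems] mult.assoc)
    finally have eq: "dz ((dz ^^ n) I) z = dz ((dz ^^ n) I) z * I z"
      unfolding I(3)[OF Suc.prems] mult_zero_right add_0_right .
    show ?case unfolding funpow.simps o_apply by (rule eq[symmetric])
  qed (use I in simp)
  show "I z * (dzbar ^^ n) I z = (dzbar ^^ n) I z"
    using assms(2)
  proof (induction n arbitrary: z)
    case (Suc n)
    have "dzbar ((dzbar ^^ n) I) z = dzbar (\<lambda>w. I w * (dzbar ^^ n) I w) z"
      unfolding dzbar_eq_wirtinger
      by (rule wirtinger_cong[OF \<Omega> Suc.prems dI(2)[OF Suc.prems, unfolded dzbar_eq_wirtinger]])
        (use Suc.IH in \<open>simp add: dzbar_eq_wirtinger\<close>)
    also have "\<dots> = dzbar I z * (dzbar ^^ n) I z + I z * dzbar ((dzbar ^^ n) I) z"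
      using wirtinger_mult[OF dI(2)[OF Suc.prems, of 0] dI(2)[OF Suc.prems]]
      by (simp add: dzbar_eq_wirtinger)
    also have "dzbar I z * (dzbar ^^ n) I z = (dzbar I z * I z) * (dzbar ^^ n) I z"
      by (metis Suc.IH[OF Suc.prems] mult.assoc)
    finally have eq: "dzbar ((dzbar ^^ n) I) z = I z * dzbar ((dzbar ^^ n) I) z"
      unfolding I(2)[OF Suc.prems] mult_zero_left add_0_left .
    show ?case unfolding funpow.simps o_apply by (rule eq[symmetric])
  qed (use I in simp)
qed

section \<open>Pairs of curves and their common polynomials\<close>

context
  fixes I J :: "complex \<Rightarrow> 'u::cstar_algebra_1"
  assumes I: "ext_hol_curve \<Omega> I" and J: "ext_hol_curve \<Omega> J"
begin

lemma real_analytic_pure: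
  "real_analytic_map_on ((wirtinger k ^^ n) I) \<Omega>" "real_analytic_map_on ((wirtinger k ^^ n) J) \<Omega>"
  using I J \<Omega> by (auto simp: ext_hol_curve_def intro: real_analytic_wirtinger_funpow)

text \<open>The generators here are only the powers in the direction \<open>k\<close> and the first derivative in the
  direction \<open>l\<close>, so that closure under \<open>wirtinger k\<close> is already known; commuting the two
  derivatives then gives the induction step.\<close>

lemma generated_mixed_step:
  fixes k l n
  defines "S \<equiv> \<lambda>F G. (\<exists>n. F = (wirtinger k ^^ n) I \<and> G = (wirtinger k ^^ n) J) \<or>
    F = wirtinger l I \<and> G = wirtinger l J"
  assumes step: "generated \<Omega> S (wirtinger k (wirtinger l I)) (wirtinger k (wirtinger l J))"
  shows "generated \<Omega> S (wirtinger l ((wirtinger k ^^ n) I)) (wirtinger l ((wirtinger k ^^ n) J))"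
proof -
  have diff: "F differentiable at z \<and> G differentiable at z" if "S F G" "z \<in> \<Omega>" for F G z
    using that real_analytic_differentiable[OF real_analytic_pure(1) \<Omega> that(2)]
      real_analytic_differentiable[OF real_analytic_pure(2) \<Omega> that(2)]
    unfolding S_def by (metis funpow.simps(2) funpow_0 o_apply One_nat_def)
  have clos: "generated \<Omega> S (wirtinger k F) (wirtinger k G)" if "S F G" for F G
    using that unfolding S_def
  proof (elim disjE exE conjE)
    fix n assume "F = (wirtinger k ^^ n) I" "G = (wirtinger k ^^ n) J"
    then have "S (wirtinger k F) (wirtinger k G)"
      unfolding S_def by (intro disjI1 exI[of _ "Suc n"]) simp
    then show "generated \<Omega> (\<lambda>F G. (\<exists>n. F = (wirtinger k ^^ n) I \<and> G = (wirtinger k ^^ n) J) \<or>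
        F = wirtinger l I \<and> G = wirtinger l J) (wirtinger k F) (wirtinger k G)"
      unfolding S_def[symmetric] by (rule generated.base)
  qed (use step S_def in simp)
  show ?thesis
  proof (induction n)
    case 0
    have "S (wirtinger l I) (wirtinger l J)" by (simp add: S_def)
    then show ?case by (simp add: generated.base)
  next
    case (Suc n)
    show ?case
      by (rule generated.cong[OF generated_wirtinger[OF Suc.IH \<Omega> diff clos]])
        (use wirtinger_commute[OF real_analytic_pure(1) \<Omega>] wirtinger_commute[OF real_analytic_pure(2) \<Omega>] in auto)
  qed
qed

text \<open>Order 0 is included, so the pair of \<open>I\<close> and \<open>J\<close> is itself a
  generator; the curvatures use it as a factor.\<close>

definition pure_derivs where
  "pure_derivs F G \<longleftrightarrow> (\<exists>n. F = (dz ^^ n) I \<and> G = (dz ^^ n) J) \<or> (\<exists>n. F = (dzbar ^^ n) I \<and> G = (dzbar ^^ n) J)"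

lemma pure_derivs_differentiable:
  "pure_derivs F G \<Longrightarrow> z \<in> \<Omega> \<Longrightarrow> F differentiable at z \<and> G differentiable at z"
  using real_analytic_differentiable[OF real_analytic_pure(1) \<Omega>]
    real_analytic_differentiable[OF real_analytic_pure(2) \<Omega>]
  by (auto simp: pure_derivs_def dz_eq_wirtinger dzbar_eq_wirtinger)

text \<open>\<open>S\<close> stays free because the formula serves two generator systems, with the
  roles of \<open>dz\<close> and \<open>dzbar\<close> exchanged.\<close>

lemma generated_commutator:
  assumes "S (dz I) (dz J)" "S (dzbar I) (dzbar J)"
  shows "generated \<Omega> S (dz (dzbar I)) (dz (dzbar J))" "generated \<Omega> S (dzbar (dz I)) (dzbar (dz J))"
proof -
  have "generated \<Omega> S (\<lambda>z. dz I z * dzbar I z + (-1) *\<^sub>C (dzbar I z * dz I z))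
      (\<lambda>z. dz J z * dzbar J z + (-1) *\<^sub>C (dzbar J z * dz J z))"
    using assms by (intro generated.intros(1-4))
  then show "generated \<Omega> S (dz (dzbar I)) (dz (dzbar J))" "generated \<Omega> S (dzbar (dz I)) (dzbar (dz J))"
    by (auto elim!: generated.cong simp: ext_hol_curve_mixed_deriv[OF I] ext_hol_curve_mixed_deriv[OF J]
        scaleC_minus_left)
qed

lemma generated_pure_derivs_closed:
  assumes "generated \<Omega> pure_derivs F G"
  shows "generated \<Omega> pure_derivs (dz F) (dz G)" "generated \<Omega> pure_derivs (dzbar F) (dzbar G)"
proof -
  have base: "pure_derivs ((dz ^^ n) I) ((dz ^^ n) J)" "pure_derivs ((dzbar ^^ n) I) ((dzbar ^^ n) J)" for n
    by (auto simp: pure_derivs_def)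
  note base1 = base[of 1, simplified]
  \<comment> \<open>The generators used for the mixed step, all powers in one direction and a single
    first derivative in the other, are contained in \<open>pure_derivs\<close>.\<close>
  have A: "generated \<Omega> pure_derivs (dzbar ((dz ^^ n) I)) (dzbar ((dz ^^ n) J))" for n
  proof (rule generated_subset)
    show "generated \<Omega> (\<lambda>F G. (\<exists>n. F = (dz ^^ n) I \<and> G = (dz ^^ n) J) \<or> F = dzbar I \<and> G = dzbar J)
      (dzbar ((dz ^^ n) I)) (dzbar ((dz ^^ n) J))"
      unfolding dz_eq_wirtinger dzbar_eq_wirtinger
      by (rule generated_mixed_step, fold dz_eq_wirtinger dzbar_eq_wirtinger, rule generated_commutator)
        (auto intro: exI[of _ 1])
  qed (use base base1 in \<open>auto intro: generated.base\<close>)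
  have B: "generated \<Omega> pure_derivs (dz ((dzbar ^^ n) I)) (dz ((dzbar ^^ n) J))" for n
  proof (rule generated_subset)
    show "generated \<Omega> (\<lambda>F G. (\<exists>n. F = (dzbar ^^ n) I \<and> G = (dzbar ^^ n) J) \<or> F = dz I \<and> G = dz J)
      (dz ((dzbar ^^ n) I)) (dz ((dzbar ^^ n) J))"
      unfolding dz_eq_wirtinger dzbar_eq_wirtinger
      by (rule generated_mixed_step, fold dz_eq_wirtinger dzbar_eq_wirtinger, rule generated_commutator)
        (auto intro: exI[of _ 1])
  qed (use base base1 in \<open>auto intro: generated.base\<close>)
  have suc: "generated \<Omega> pure_derivs (dz ((dz ^^ n) I)) (dz ((dz ^^ n) J))"
    "generated \<Omega> pure_derivs (dzbar ((dzbar ^^ n) I)) (dzbar ((dzbar ^^ n) J))" for n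
    using generated.base[where S = pure_derivs, OF base(1)[of "Suc n"]]
      generated.base[where S = pure_derivs, OF base(2)[of "Suc n"]] by simp_all
  have S: "generated \<Omega> pure_derivs (dz F) (dz G)" "generated \<Omega> pure_derivs (dzbar F) (dzbar G)"
    if "pure_derivs F G" for F G
    using that A B suc unfolding pure_derivs_def[of F G] by auto
  show "generated \<Omega> pure_derivs (dz F) (dz G)" "generated \<Omega> pure_derivs (dzbar F) (dzbar G)"
    using generated_wirtinger[OF assms \<Omega> pure_derivs_differentiable] S
    unfolding dz_eq_wirtinger dzbar_eq_wirtinger by blast+
qed

lemma generated_ext_curvature: "generated \<Omega> pure_derivs (ext_curvature I i j) (ext_curvature J i j)"
proof (induction j)
  case 0
  have self: "generated \<Omega> pure_derivs I J"
    by (rule generated.base) (auto simp: pure_derivs_def intro: exI[of _ 0])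
  show ?case
    by (induction i) (auto intro: generated.mult generated_pure_derivs_closed self)
next
  case (Suc j)
  have self: "generated \<Omega> pure_derivs I J"
    by (rule generated.base) (auto simp: pure_derivs_def intro: exI[of _ 0])
  show ?case
    using Suc by (cases i) (auto intro: generated.mult generated_pure_derivs_closed self)
qed

section \<open>Similarity and intertwining at one point\<close>

lemma similar_imp_pure_derivs_intertwine:
  assumes "\<And>z. z \<in> \<Omega> \<Longrightarrow> X * I z = J z * X" "z \<in> \<Omega>"
  shows "X * (wirtinger k ^^ n) I z = (wirtinger k ^^ n) J z * X"
  using assms(2)
proof (induction n arbitrary: z)
  case (Suc n)
  note diff = real_analytic_differentiable[OF real_analytic_pure(1) \<Omega> Suc.prems, of n k]
    real_analytic_differentiable[OF real_analytic_pure(2) \<Omega> Suc.prems, of n k]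
  have "X * wirtinger k ((wirtinger k ^^ n) I) z = wirtinger k (\<lambda>z. X * (wirtinger k ^^ n) I z) z"
    using diff(1) by (intro wirtinger_bounded_linear[symmetric] bounded_linear_mult_right)
      (auto simp: scaleC_mult_right)
  also have "\<dots> = wirtinger k (\<lambda>z. (wirtinger k ^^ n) J z * X) z"
    using differentiable_bounded_linear[OF bounded_linear_mult_right diff(1)] Suc.IH
    by (intro wirtinger_cong[OF \<Omega> Suc.prems]) auto
  also have "\<dots> = wirtinger k ((wirtinger k ^^ n) J) z * X"
    using diff(2) by (intro wirtinger_bounded_linear bounded_linear_mult_left)
      (auto simp: scaleC_mult_left)
  finally show ?case by simp
qed (use assms(1) in simp)

lemma pure_derivs_intertwine_imp_similar:
  assumes "connected \<Omega>" "z0 \<in> \<Omega>" "z \<in> \<Omega>"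
    and "\<And>F G. pure_derivs F G \<Longrightarrow> X * F z0 = G z0 * X"
  shows "X * I z = J z * X"
proof -
  \<comment> \<open>The defect of intertwining, linear in the pair: differentiating it
    differentiates \<open>F\<close> and \<open>G\<close> separately.\<close>
  define L where "L = (\<lambda>F G (z::complex). X * F z + - (G z * X))"
  have LX: "bounded_linear (\<lambda>u. X * u)" and RX: "bounded_linear (\<lambda>u. - (u * X))"
    by (intro bounded_linear_mult_right bounded_linear_minus bounded_linear_mult_left)+
  have ra: "real_analytic_map_on (L I J) \<Omega>"
    unfolding L_def using I J
    by (intro real_analytic_add real_analytic_bounded_linear[OF LX] real_analytic_bounded_linear[OF RX])
      (auto simp: ext_hol_curve_def)
  have closed: "generated \<Omega> pure_derivs (directional_deriv v F) (directional_deriv v G)"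
    if "generated \<Omega> pure_derivs F G" "v = 1 \<or> v = \<i>" for F G v
  proof -
    have "directional_deriv 1 h = (\<lambda>z. dz h z + dzbar h z)"
      "directional_deriv \<i> h = (\<lambda>z. \<i> *\<^sub>C (dz h z + (-1) *\<^sub>C dzbar h z))" for h :: "complex \<Rightarrow> 'u"
      by (simp_all only: fun_eq_iff directional_deriv_wirtinger dz_eq_wirtinger dzbar_eq_wirtinger simp_thms)
    then show ?thesis
      using that(2) generated_pure_derivs_closed[OF that(1)]
      by (elim disjE) (simp_all only: generated.add generated.scaleC)
  qed
  have dL: "directional_deriv v (L F G) z = L (directional_deriv v F) (directional_deriv v G) z"
    if "generated \<Omega> pure_derivs F G" "z \<in> \<Omega>" for F G v z
  proof -
    have d: "F differentiable at z" "G differentiable at z"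
      using generated_differentiable[OF that(1) pure_derivs_differentiable \<Omega> that(2)] by auto
    show ?thesis
      using directional_deriv_add[OF differentiable_bounded_linear[OF LX d(1)] differentiable_bounded_linear[OF RX d(2)]]
        directional_deriv_bounded_linear[OF LX d(1)] directional_deriv_bounded_linear[OF RX d(2)]
      by (simp add: L_def)
  qed
  \<comment> \<open>Invariant for the induction over \<open>partial_derivs\<close>: each derivative
    of \<open>L I J\<close> is the defect of some generated pair. Agreement on all of \<Omega>, not
    just at \<open>z0\<close>, is what allows it to be differentiated again.\<close>
  have step: "\<exists>F G. generated \<Omega> pure_derivs F G \<and> (\<forall>z\<in>\<Omega>. L F G z = directional_deriv v g z)"
    if "\<exists>F G. generated \<Omega> pure_derivs F G \<and> (\<forall>z\<in>\<Omega>. L F G z = g z)" and v: "v = 1 \<or> v = \<i>"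
      and ra: "real_analytic_map_on g \<Omega>" for g v
  proof -
    from that(1) obtain F G where FG: "generated \<Omega> pure_derivs F G" "\<And>z. z \<in> \<Omega> \<Longrightarrow> L F G z = g z" by blast
    have "directional_deriv v g z = L (directional_deriv v F) (directional_deriv v G) z" if "z \<in> \<Omega>" for z
      using directional_deriv_cong[OF \<Omega> that real_analytic_differentiable[OF ra \<Omega> that], of "L F G"]
        FG(2) dL[OF FG(1) that] by simp
    then have "\<forall>z\<in>\<Omega>. L (directional_deriv v F) (directional_deriv v G) z = directional_deriv v g z" by simp
    with closed[OF FG(1) v] show ?thesis by blast
  qed
  have "\<exists>F G. generated \<Omega> pure_derivs F G \<and> (\<forall>z\<in>\<Omega>. L F G z = g z)" if "g \<in> partial_derivs (L I J)" for g
    using that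
  proof induction
    case self
    have "generated \<Omega> pure_derivs I J"
      by (rule generated.base) (auto simp: pure_derivs_def intro: exI[of _ 0])
    then show ?case by blast
  next
    case (re g)
    show ?case
      by (rule step[OF re.IH _ real_analytic_partial_derivs[OF ra \<Omega> re.hyps]]) simp
  next
    case (im g)
    show ?case
      by (rule step[OF im.IH _ real_analytic_partial_derivs[OF ra \<Omega> im.hyps]]) simp
  qed
  moreover have "L F G z0 = 0" if "generated \<Omega> pure_derivs F G" for F G
  proof -
    have "X * F z0 = G z0 * X"
      by (rule generated_intertwine[OF that _ assms(2)]) (rule assms(4))
    then show ?thesis by (simp add: L_def)
  qed
  ultimately have vanish: "g z0 = 0" if "g \<in> partial_derivs (L I J)" for g
    using that assms(2) by fastforce
  have "L I J z = 0"
    by (rule real_analytic_identity[OF ra \<Omega> assms(1,2) _ assms(3)]) (rule vanish)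
  then show ?thesis by (simp add: L_def)
qed

theorem similar_curves_iff:
  assumes "connected \<Omega>" "\<Omega> \<noteq> {}"
  shows "similar_curves \<Omega> I J \<longleftrightarrow>
    (\<exists>z0\<in>\<Omega>. \<exists>X. invertible_elem X \<and>
      (\<forall>i j. X * ext_curvature I i j z0 = ext_curvature J i j z0 * X) \<and>
      (\<forall>i j. X * ((dz ^^ i) I z0 * (dzbar ^^ j) I z0) =
        ((dz ^^ i) J z0 * (dzbar ^^ j) J z0) * X))" (is "_ \<longleftrightarrow> ?R")
proof
  assume "similar_curves \<Omega> I J"
  then obtain X where X: "invertible_elem X" "\<And>z. z \<in> \<Omega> \<Longrightarrow> X * I z = J z * X"
    by (auto simp: similar_curves_def)
  obtain z0 where z0: "z0 \<in> \<Omega>" using assms(2) by blast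
  note pure = similar_imp_pure_derivs_intertwine[OF X(2) z0]
  have base: "X * F z0 = G z0 * X" if "pure_derivs F G" for F G
    using that pure by (auto simp: pure_derivs_def dz_eq_wirtinger dzbar_eq_wirtinger)
  have "X * ext_curvature I i j z0 = ext_curvature J i j z0 * X" for i j
    by (rule generated_intertwine[OF generated_ext_curvature _ z0]) (rule base)
  moreover have "X * ((dz ^^ i) I z0 * (dzbar ^^ j) I z0) = ((dz ^^ i) J z0 * (dzbar ^^ j) J z0) * X" for i j
    unfolding dz_eq_wirtinger dzbar_eq_wirtinger 
    \<comment> \<open>Associated to the left, \<open>X\<close> moves past the first factor;
      reassociated to the right, past the second.\<close>
    by (simp only: mult.assoc[symmetric] pure) (simp only: mult.assoc pure)
  ultimately show ?R using X(1) z0 by blast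
next
  assume ?R
  then obtain z0 X where X: "z0 \<in> \<Omega>" "invertible_elem X"
    "\<And>i j. X * ((dz ^^ i) I z0 * (dzbar ^^ j) I z0) = ((dz ^^ i) J z0 * (dzbar ^^ j) J z0) * X"
    by blast
  have "X * (dz ^^ n) I z0 = (dz ^^ n) J z0 * X" "X * (dzbar ^^ n) I z0 = (dzbar ^^ n) J z0 * X" for n
    using X(3)[of n 0] X(3)[of 0 n] ext_hol_curve_pure_deriv[OF I X(1), of n]
      ext_hol_curve_pure_deriv[OF J X(1), of n] by simp_all
  then have base: "X * F z0 = G z0 * X" if "pure_derivs F G" for F G
    using that by (auto simp: pure_derivs_def)
  have "X * I z = J z * X" if "z \<in> \<Omega>" for z
    by (rule pure_derivs_intertwine_imp_similar[OF assms(1) X(1) that]) (rule base)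
  with X(2) show "similar_curves \<Omega> I J" by (auto simp: similar_curves_def)
qed

end

end

theorem theorem2p18:
  fixes \<Omega> :: "complex set"
    and I J :: "complex \<Rightarrow> 'b::cstar_algebra_1 adjop"
  assumes "open \<Omega>" and "connected \<Omega>" and "\<Omega> \<noteq> {}"
    and "I \<in> curve_class TYPE('n::finite) \<Omega>"
    and "J \<in> curve_class TYPE('n) \<Omega>"
  shows "similar_curves \<Omega> I J \<longleftrightarrow>
    (\<exists>z0\<in>\<Omega>. \<exists>X. invertible_elem X \<and>
      (\<forall>i j. X * ext_curvature I i j z0 = ext_curvature J i j z0 * X) \<and>
      (\<forall>i j. X * ((dz ^^ i) I z0 * (dzbar ^^ j) I z0) =
        ((dz ^^ i) J z0 * (dzbar ^^ j) J z0) * X))"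
  using assms(4,5) by (intro similar_curves_iff[OF assms(1) _ _ assms(2,3)]) (auto simp: curve_class_def)

end
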